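(* Let $\alpha\in(0,1]$, $\tilde\alpha\ge0$ and $d\in\{1,2,3,4\}$. There is a constant $C=C(\alpha,\tilde\alpha,d)>0$ such that the following holds for every $n$. Let $J$ be a real symmetric $n\times n$ matrix with $J_{ii}=0$ and $\max_i\sum_j|J_{ij}|\le1-\alpha$, let $h\in\mathbb{R}^n$ with $\|h\|_\infty\le\tilde\alpha$, let $q^n$ be the probability measure on $\{-1,+1\}^n$ proportional to $\exp\big(\tfrac12\sum_{i,j}J_{ij}\sigma_i\sigma_j+\sum_ih_i\sigma_i\big)$, and let $X=(X_1,\ldots,X_n)$ have law $q^n$. Let $A=(a_{i_1\ldots i_d})_{i_1,\ldots,i_d=1}^n$ be a symmetric real $d$-tensor with vanishing diagonal and let $f_{d,A}$ be as defined in the context. Then for all $t>0$ \[ q^n\big(|f_{d,A}-\mathbb{E}_{q^n}f_{d,A}|>t\big)\le 2\exp\Big(-\frac{t^{2/d}}{C\|A\|_{HS}^{2/d}}\Big)\le 2\exp\Big(-\frac{t^{2/d}}{Cn\|A\|_\infty^{2/d}}\Big). \]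
   Context: $\mathbb{E}$ denotes expectation under $q^n$. $\tilde X_i=X_i-\mathbb{E}X_i$ and for indices $i_1,\ldots,i_k$, $\tilde X_{i_1\ldots i_k}=\prod_{m=1}^k\tilde X_{i_m}$. A tensor is symmetric if $a_{i_1\ldots i_d}=a_{i_{\pi(1)}\ldots i_{\pi(d)}}$ for every permutation $\pi$ of $\{1,\ldots,d\}$; it has vanishing diagonal if $a_{i_1\ldots i_d}=0$ whenever $|\{i_1,\ldots,i_d\}|<d$. $\|A\|_{HS}=(\sum_{i_1,\ldots,i_d}a_{i_1\ldots i_d}^2)^{1/2}$, $\|A\|_\infty=\max|a_{i_1\ldots i_d}|$. The functions are $f_{1,A}=\sum_i a_i\tilde X_i$; $f_{2,A}=\sum_{i,j}a_{ij}(\tilde X_{ij}-\mathbb{E}\tilde X_{ij})$; $f_{3,A}=\sum_{i,j,k}a_{ijk}(\tilde X_{ijk}-\mathbb{E}\tilde X_{ijk}-3\tilde X_i\mathbb{E}\tilde X_{jk})$; $f_{4,A}=\sum_{i,j,k,l}a_{ijkl}(\tilde X_{ijkl}-\mathbb{E}\tilde X_{ijkl}-4\tilde X_i\mathbb{E}\tilde X_{jkl}-6\tilde X_{ij}\mathbb{E}\tilde X_{kl}+6\mathbb{E}\tilde X_{ij}\mathbb{E}\tilde X_{kl})$. *)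

theory Defs
  imports Complex_Main "HOL-Combinatorics.Permutations"
begin

definition cube :: "nat \<Rightarrow> (nat \<Rightarrow> real) set" where
  "cube n = PiE {..<n} (\<lambda>_. {-1, 1})"

definition gibbs_weight :: "nat \<Rightarrow> (nat \<Rightarrow> nat \<Rightarrow> real) \<Rightarrow> (nat \<Rightarrow> real) \<Rightarrow> (nat \<Rightarrow> real) \<Rightarrow> real" where
  "gibbs_weight n J h \<sigma> =
     exp ((1/2) * (\<Sum>i<n. \<Sum>j<n. J i j * \<sigma> i * \<sigma> j) + (\<Sum>i<n. h i * \<sigma> i))"

definition partition_fn :: "nat \<Rightarrow> (nat \<Rightarrow> nat \<Rightarrow> real) \<Rightarrow> (nat \<Rightarrow> real) \<Rightarrow> real" where
  "partition_fn n J h = (\<Sum>\<sigma>\<in>cube n. gibbs_weight n J h \<sigma>)"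

definition qE :: "nat \<Rightarrow> (nat \<Rightarrow> nat \<Rightarrow> real) \<Rightarrow> (nat \<Rightarrow> real) \<Rightarrow> ((nat \<Rightarrow> real) \<Rightarrow> real) \<Rightarrow> real" where
  "qE n J h F = (\<Sum>\<sigma>\<in>cube n. gibbs_weight n J h \<sigma> * F \<sigma>) / partition_fn n J h"

definition qprob :: "nat \<Rightarrow> (nat \<Rightarrow> nat \<Rightarrow> real) \<Rightarrow> (nat \<Rightarrow> real) \<Rightarrow> ((nat \<Rightarrow> real) \<Rightarrow> bool) \<Rightarrow> real" where
  "qprob n J h P = (\<Sum>\<sigma>\<in>{\<sigma>\<in>cube n. P \<sigma>}. gibbs_weight n J h \<sigma>) / partition_fn n J h"

definition xt :: "nat \<Rightarrow> (nat \<Rightarrow> nat \<Rightarrow> real) \<Rightarrow> (nat \<Rightarrow> real) \<Rightarrow> nat \<Rightarrow> (nat \<Rightarrow> real) \<Rightarrow> real" where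
  "xt n J h i \<sigma> = \<sigma> i - qE n J h (\<lambda>\<tau>. \<tau> i)"

definition xtp :: "nat \<Rightarrow> (nat \<Rightarrow> nat \<Rightarrow> real) \<Rightarrow> (nat \<Rightarrow> real) \<Rightarrow> nat list \<Rightarrow> (nat \<Rightarrow> real) \<Rightarrow> real" where
  "xtp n J h is \<sigma> = prod_list (map (\<lambda>i. xt n J h i \<sigma>) is)"

definition ext :: "nat \<Rightarrow> (nat \<Rightarrow> nat \<Rightarrow> real) \<Rightarrow> (nat \<Rightarrow> real) \<Rightarrow> nat list \<Rightarrow> real" where
  "ext n J h is = qE n J h (xtp n J h is)"

text \<open>Tensors of order d are functions on index lists (of length d, entries in {..<n},
  0-based indices).\<close>
definition index_tuples :: "nat \<Rightarrow> nat \<Rightarrow> nat list set" where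
  "index_tuples n d = {is. length is = d \<and> set is \<subseteq> {..<n}}"

definition sym_tensor :: "nat \<Rightarrow> nat \<Rightarrow> (nat list \<Rightarrow> real) \<Rightarrow> bool" where
  "sym_tensor n d A \<longleftrightarrow>
     (\<forall>is\<in>index_tuples n d. \<forall>\<pi>. \<pi> permutes {..<d} \<longrightarrow> A is = A (map (\<lambda>k. is ! \<pi> k) [0..<d]))"

definition vanishing_diag :: "nat \<Rightarrow> nat \<Rightarrow> (nat list \<Rightarrow> real) \<Rightarrow> bool" where
  "vanishing_diag n d A \<longleftrightarrow> (\<forall>is\<in>index_tuples n d. card (set is) < d \<longrightarrow> A is = 0)"

definition hs_norm :: "nat \<Rightarrow> nat \<Rightarrow> (nat list \<Rightarrow> real) \<Rightarrow> real" where
  "hs_norm n d A = sqrt (\<Sum>is\<in>index_tuples n d. (A is)\<^sup>2)"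

text \<open>Max of |entries| (the insert 0 only matters for the empty index set, n = 0).\<close>
definition inf_norm :: "nat \<Rightarrow> nat \<Rightarrow> (nat list \<Rightarrow> real) \<Rightarrow> real" where
  "inf_norm n d A = Max (insert 0 ((\<lambda>is. \<bar>A is\<bar>) ` index_tuples n d))"

definition fdA :: "nat \<Rightarrow> (nat \<Rightarrow> nat \<Rightarrow> real) \<Rightarrow> (nat \<Rightarrow> real) \<Rightarrow> nat \<Rightarrow> (nat list \<Rightarrow> real) \<Rightarrow> (nat \<Rightarrow> real) \<Rightarrow> real" where
  "fdA n J h d A \<sigma> =
    (if d = 1 then (\<Sum>i<n. A [i] * xt n J h i \<sigma>)
     else if d = 2 then (\<Sum>i<n. \<Sum>j<n. A [i,j] * (xtp n J h [i,j] \<sigma> - ext n J h [i,j]))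
     else if d = 3 then (\<Sum>i<n. \<Sum>j<n. \<Sum>k<n. A [i,j,k] *
        (xtp n J h [i,j,k] \<sigma> - ext n J h [i,j,k] - 3 * xt n J h i \<sigma> * ext n J h [j,k]))
     else if d = 4 then (\<Sum>i<n. \<Sum>j<n. \<Sum>k<n. \<Sum>l<n. A [i,j,k,l] *
        (xtp n J h [i,j,k,l] \<sigma> - ext n J h [i,j,k,l] - 4 * xt n J h i \<sigma> * ext n J h [j,k,l]
         - 6 * xtp n J h [i,j] \<sigma> * ext n J h [k,l] + 6 * ext n J h [i,j] * ext n J h [k,l]))
     else 0)"

end

theory Submission
  imports Defs "HOL-Analysis.L2_Norm" "HOL-Analysis.Convex" "HOL-Library.Nat_Bijection"
begin

text \<open>
  Under the row sum condition, Dobrushin's comparison argument bounds the difference between the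
  magnetizations of the measure q and of any measure with positive density with respect to q by the
  differences of the single-spin conditional expectations, in the Euclidean norm. By an induction of
  Marton that reveals the spins in random order, this yields approximate tensorization of entropy
  and hence a logarithmic Sobolev inequality. Applied to a power of g, the latter bounds the moment
  of order 2p of g by its moment of order p and by a moment of its discrete gradient. Iterated along
  p = 2, 4, 8, ... this shows that the norm of a centered function in L^p is at most a constant times
  the square root of p times the norm of its gradient. The discrete derivative of a polynomial
  belonging to a d-tensor is d times the polynomial belonging to a slice of the tensor, which is
  again centered, so that d-fold iteration leads to the constant Hilbert-Schmidt norm and to moments
  growing like the power d/2 of p. Markov's inequality with optimized p concludes.
\<close>

section \<open>Conditional expectations on the cube\<close>

text \<open>Revealing spins one by one means conditioning, so everything is stated for a finite set
  S of free spins with a frozen boundary x. Freezing spins only shrinks the row sums, and the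
  hypotheses pass to the smaller system with the same constants. Symmetry of the influence matrix
  gives column sums as well as row sums, hence an l2 operator norm of at most 1 - \<alpha>; this
  makes the comparison Euclidean and keeps n out of the constants. Iterating the moment bound meets
  an obstacle: the norm of a gradient is not centered, although its components are. The bound is
  therefore proved for vectors of functions. The components are centered and give the second moment
  through a Poincare inequality; the Euclidean norm is Lipschitz and gives the growth in the
  exponent. Exponents that are powers of two keep the argument algebraic: a single passage from
  order m to order 2m takes the place of a differential inequality in the exponent. Rounding the
  optimal exponent to a power of two costs only a factor 2 in the final constant.\<close>

definition cfg :: "'i set \<Rightarrow> ('i \<Rightarrow> real) \<Rightarrow> ('i \<Rightarrow> real) set" where
  "cfg S x = {y. (\<forall>i\<in>S. y i \<in> {-1, 1}) \<and> (\<forall>i. i \<notin> S \<longrightarrow> y i = x i)}"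

text \<open>As a function of x this is the conditional expectation given the spins outside S, so
  repeated conditioning is composition. The values of x off S are arbitrary, which lets the whole
  cube appear as the case \<open>x = (\<lambda>_. undefined)\<close>.\<close>

definition cE :: "(('i \<Rightarrow> real) \<Rightarrow> real) \<Rightarrow> 'i set \<Rightarrow> (('i \<Rightarrow> real) \<Rightarrow> real) \<Rightarrow> ('i \<Rightarrow> real) \<Rightarrow> real" where
  "cE w S f x = (\<Sum>y\<in>cfg S x. w y * f y) / (\<Sum>y\<in>cfg S x. w y)"

text \<open>The factor 1/2 makes this the slope of f as an affine function of the spin
  \<open>y i\<close>; for a multilinear polynomial it is the partial derivative.\<close>

definition spin_diff :: "'i \<Rightarrow> (('i \<Rightarrow> real) \<Rightarrow> real) \<Rightarrow> ('i \<Rightarrow> real) \<Rightarrow> real" where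
  "spin_diff i f y = (f (y(i := 1)) - f (y(i := -1))) / 2"

definition mag :: "(('i \<Rightarrow> real) \<Rightarrow> real) \<Rightarrow> 'i \<Rightarrow> ('i \<Rightarrow> real) \<Rightarrow> real" where
  "mag w i = cE w {i} (\<lambda>y. y i)"

lemma cfg_empty [simp]: "cfg {} x = {x}"
  by (auto simp: cfg_def)

lemma cfg_insert:
  assumes "i \<notin> S"
  shows "cfg (insert i S) x = cfg S (x(i := 1)) \<union> cfg S (x(i := -1))"
  using assms by (auto simp: cfg_def split: if_splits)

lemma cfg_single: "cfg {i} x = {x(i := 1), x(i := -1)}"
  by (auto simp: cfg_insert)

lemma finite_cfg [simp]: "finite S \<Longrightarrow> finite (cfg S x)"
  by (induction S arbitrary: x rule: finite_induct) (simp_all add: cfg_insert)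

lemma cfg_nonempty [simp]: "cfg S x \<noteq> {}"
proof -
  have "(\<lambda>i. if i \<in> S then 1 else x i) \<in> cfg S x"
    by (auto simp: cfg_def)
  then show ?thesis by blast
qed

lemma cfg_eq: "T \<subseteq> S \<Longrightarrow> z \<in> cfg T y \<Longrightarrow> cfg S z = cfg S y"
  by (auto simp: cfg_def subset_iff)

lemma cfg_subset: "T \<subseteq> S \<Longrightarrow> y \<in> cfg S x \<Longrightarrow> cfg T y \<subseteq> cfg S x"
  by (auto simp: cfg_def subset_iff) metis+

lemma cfg_upd: "y \<in> cfg S x \<Longrightarrow> i \<in> S \<Longrightarrow> s \<in> {-1, 1} \<Longrightarrow> y(i := s) \<in> cfg S x"
  by (auto simp: cfg_def)

lemma cfg_spin: "y \<in> cfg S x \<Longrightarrow> i \<in> S \<Longrightarrow> y i = 1 \<or> y i = -1"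
  by (auto simp: cfg_def)

context
  fixes w :: "('i \<Rightarrow> real) \<Rightarrow> real"
  assumes w_pos: "\<And>y. 0 < w y"
begin

lemma part_pos: "finite S \<Longrightarrow> 0 < (\<Sum>y\<in>cfg S x. w y)"
  by (intro sum_pos) (auto simp: w_pos)

lemma cE_add: "cE w S (\<lambda>y. f y + g y) x = cE w S f x + cE w S g x"
  by (simp add: cE_def algebra_simps sum.distrib add_divide_distrib)

lemma cE_diff: "cE w S (\<lambda>y. f y - g y) x = cE w S f x - cE w S g x"
  by (simp add: cE_def algebra_simps sum_subtractf diff_divide_distrib)

lemma cE_cmult: "cE w S (\<lambda>y. k * f y) x = k * cE w S f x"
  by (simp add: cE_def sum_distrib_left mult.left_commute)

lemma cE_cmult_right: "cE w S (\<lambda>y. f y * k) x = cE w S f x * k"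
  using cE_cmult[of S k f x] by (simp add: mult.commute)

lemma cE_sum: "cE w S (\<lambda>y. \<Sum>a\<in>I. f a y) x = (\<Sum>a\<in>I. cE w S (f a) x)"
proof (cases "finite I")
  case True
  then show ?thesis
    by (induction I rule: finite_induct) (simp_all add: cE_add, simp add: cE_def)
qed (simp add: cE_def)

lemma cE_const: "finite S \<Longrightarrow> cE w S (\<lambda>y. k) x = k"
  using part_pos[of S x] by (simp add: cE_def flip: sum_distrib_right)

lemma cE_cong: "(\<And>y. y \<in> cfg S x \<Longrightarrow> f y = g y) \<Longrightarrow> cE w S f x = cE w S g x"
  by (simp add: cE_def)

lemma cE_mono:
  assumes "finite S" "\<And>y. y \<in> cfg S x \<Longrightarrow> f y \<le> g y"
  shows "cE w S f x \<le> cE w S g x"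
  unfolding cE_def using assms part_pos[of S x] w_pos
  by (intro divide_right_mono sum_mono mult_left_mono) (auto intro: less_imp_le)

lemma cE_nonneg:
  assumes "finite S" "\<And>y. y \<in> cfg S x \<Longrightarrow> 0 \<le> f y"
  shows "0 \<le> cE w S f x"
  using cE_mono[of S x "\<lambda>_. 0" f] assms by (simp add: cE_const)

lemma cE_pos:
  assumes "finite S" "\<And>y. y \<in> cfg S x \<Longrightarrow> 0 < f y"
  shows "0 < cE w S f x"
  unfolding cE_def using assms part_pos[of S x] w_pos
  by (intro divide_pos_pos sum_pos) auto

lemma cE_abs_le:
  assumes "finite S"
  shows "\<bar>cE w S f x\<bar> \<le> cE w S (\<lambda>y. \<bar>f y\<bar>) x"
proof (rule abs_leI)
  show "cE w S f x \<le> cE w S (\<lambda>y. \<bar>f y\<bar>) x"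
    using assms by (intro cE_mono) auto
  have "cE w S (\<lambda>y. (-1) * f y) x \<le> cE w S (\<lambda>y. \<bar>f y\<bar>) x"
    using assms by (intro cE_mono) auto
  then show "- cE w S f x \<le> cE w S (\<lambda>y. \<bar>f y\<bar>) x"
    unfolding cE_cmult by simp
qed

lemma cE_square_le:
  assumes "finite S"
  shows "(cE w S f x)\<^sup>2 \<le> cE w S (\<lambda>y. (f y)\<^sup>2) x"
proof -
  let ?e = "cE w S f x"
  have "0 \<le> cE w S (\<lambda>y. (f y - ?e)\<^sup>2) x"
    using assms by (intro cE_nonneg) auto
  also have "(\<lambda>y. (f y - ?e)\<^sup>2) = (\<lambda>y. ((f y)\<^sup>2 - 2 * ?e * f y) + ?e\<^sup>2)"
    by (auto simp: power2_eq_square algebra_simps)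
  also have "cE w S \<dots> x = cE w S (\<lambda>y. (f y)\<^sup>2) x - ?e\<^sup>2"
    using assms by (simp only: cE_add cE_diff cE_cmult cE_const)
       (simp add: power2_eq_square)
  finally show ?thesis by simp
qed

lemma cE_cfg_cong: "T \<subseteq> S \<Longrightarrow> z \<in> cfg T y \<Longrightarrow> cE w S f z = cE w S f y"
  by (simp add: cE_def cfg_eq)

lemma cE_pull_out:
  assumes "\<And>z. z \<in> cfg T y \<Longrightarrow> h z = h y"
  shows "cE w T (\<lambda>z. h z * f z) y = h y * cE w T f y"
  using cE_cong[of T y "\<lambda>z. h z * f z" "\<lambda>z. h y * f z"] assms by (simp add: cE_cmult)

text \<open>Agreement off T is a symmetric relation on configurations, and the normalizing sum is
  constant on its classes; hence the double sum over related pairs can be exchanged.\<close>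

lemma cE_tower:
  assumes S: "finite S" and TS: "T \<subseteq> S"
  shows "cE w S (cE w T f) x = cE w S f x"
proof -
  let ?A = "cfg S x"
  let ?Z = "\<lambda>y. \<Sum>u\<in>cfg T y. w u"
  have T: "finite T" using S TS by (rule rev_finite_subset)
  have rel: "cfg T y = {z \<in> ?A. z \<in> cfg T y}" if "y \<in> ?A" for y
    using cfg_subset[OF TS that] by auto
  have symm: "z \<in> cfg T y \<longleftrightarrow> y \<in> cfg T z" if "y \<in> ?A" "z \<in> ?A" for y z
    using that TS by (auto simp: cfg_def subset_iff)
  have "(\<Sum>y\<in>?A. w y * cE w T f y) = (\<Sum>y\<in>?A. \<Sum>z\<in>cfg T y. w y * (w z * f z) / ?Z z)"
  proof (rule sum.cong[OF refl])
    fix y assume y: "y \<in> ?A"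
    have "w y * cE w T f y = (\<Sum>z\<in>cfg T y. w y * (w z * f z) / ?Z y)"
      by (simp add: cE_def sum_distrib_left sum_divide_distrib)
    also have "\<dots> = (\<Sum>z\<in>cfg T y. w y * (w z * f z) / ?Z z)"
      by (intro sum.cong refl) (metis cfg_eq order_refl)
    finally show "w y * cE w T f y = (\<Sum>z\<in>cfg T y. w y * (w z * f z) / ?Z z)" .
  qed
  also have "\<dots> = (\<Sum>y\<in>?A. \<Sum>z | z \<in> ?A \<and> z \<in> cfg T y. w y * (w z * f z) / ?Z z)"
    using rel by (intro sum.cong) auto
  also have "\<dots> = (\<Sum>z\<in>?A. \<Sum>y | y \<in> ?A \<and> z \<in> cfg T y. w y * (w z * f z) / ?Z z)"
    using S by (intro sum.swap_restrict) auto
  also have "\<dots> = (\<Sum>z\<in>?A. \<Sum>y\<in>cfg T z. w y * (w z * f z) / ?Z z)"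
    using symm rel by (intro sum.cong) auto
  also have "\<dots> = (\<Sum>z\<in>?A. w z * f z)"
  proof (rule sum.cong[OF refl])
    fix z
    have "(\<Sum>y\<in>cfg T z. w y * (w z * f z) / ?Z z) = ?Z z * (w z * f z) / ?Z z"
      by (simp add: sum_distrib_right sum_divide_distrib)
    then show "(\<Sum>y\<in>cfg T z. w y * (w z * f z) / ?Z z) = w z * f z"
      using part_pos[OF T, of z] by simp
  qed
  finally show ?thesis by (simp add: cE_def)
qed

text \<open>A law on {-1, 1} is determined by its mean, so \<open>mag\<close> alone describes every
  single-spin conditional expectation.\<close>

lemma cE_single:
  "cE w {i} f y = (1 + mag w i y) / 2 * f (y(i := 1)) + (1 - mag w i y) / 2 * f (y(i := -1))"
proof -
  have ne: "y(i := 1) \<noteq> y(i := -1)"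
    by (metis fun_upd_same one_neq_neg_one)
  let ?p = "w (y(i := 1))" and ?q = "w (y(i := -1))"
  have "?p + ?q > 0" using w_pos by (simp add: add_pos_pos)
  then have m: "(1 + mag w i y) / 2 = ?p / (?p + ?q)" "(1 - mag w i y) / 2 = ?q / (?p + ?q)"
    using ne unfolding mag_def cE_def cfg_single by (simp_all add: field_simps)
  show ?thesis
    using ne unfolding m by (simp add: cE_def cfg_single add_divide_distrib)
qed

end

lemma mag_fun_upd [simp]: "mag w i (y(i := s)) = mag w i y"
  by (simp add: mag_def cE_def cfg_single)

lemma spin_diff_fun_upd [simp]: "spin_diff i f (y(i := s)) = spin_diff i f y"
  by (simp add: spin_diff_def)

section \<open>Dobrushin's comparison theorem\<close>

text \<open>The quotient is the conditional mean of spin i under the measure with density f; the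
  difference is thus the shift of this mean caused by f.\<close>

definition local_bias ::
  "(('i \<Rightarrow> real) \<Rightarrow> real) \<Rightarrow> 'i \<Rightarrow> (('i \<Rightarrow> real) \<Rightarrow> real) \<Rightarrow> ('i \<Rightarrow> real) \<Rightarrow> real" where
  "local_bias w i f y = cE w {i} (\<lambda>z. f z * z i) y / cE w {i} f y - mag w i y"

text \<open>The spins of y and z are matched one at a time; the 2 undoes the halving in
  \<open>spin_diff\<close>.\<close>

lemma oscillation_le:
  assumes "finite S" "y \<in> cfg S x" "z \<in> cfg S x"
    and "\<And>j u. j \<in> S \<Longrightarrow> u \<in> cfg S x \<Longrightarrow> \<bar>spin_diff j g u\<bar> \<le> \<delta> j"
  shows "\<bar>g y - g z\<bar> \<le> 2 * (\<Sum>j\<in>S. \<delta> j)"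
  using assms
proof (induction S arbitrary: x y z rule: finite_induct)
  case empty
  then show ?case by simp
next
  case (insert i S)
  let ?x = "x(i := y i)" and ?z = "z(i := y i)"
  have yi: "y i \<in> {-1, 1}" and zi: "z i \<in> {-1, 1}"
    using insert.prems by (auto simp: cfg_def)
  have sub: "cfg S ?x \<subseteq> cfg (insert i S) x"
    using yi cfg_insert[OF insert.hyps(2)] by auto
  have "y \<in> cfg S ?x" "?z \<in> cfg S ?x"
    using insert.prems insert.hyps(2) by (auto simp: cfg_def)
  moreover have "\<bar>spin_diff j g u\<bar> \<le> \<delta> j" if "j \<in> S" "u \<in> cfg S ?x" for j u
    using insert.prems(3)[of j u] sub that by blast
  ultimately have 1: "\<bar>g y - g ?z\<bar> \<le> 2 * (\<Sum>j\<in>S. \<delta> j)"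
    by (rule insert.IH)
  have d: "\<bar>spin_diff i g z\<bar> \<le> \<delta> i"
    using insert.prems by auto
  then have "\<bar>g (z(i := s)) - g (z(i := t))\<bar> \<le> 2 * \<delta> i" if "s \<in> {-1, 1}" "t \<in> {-1, 1}" for s t
    using that unfolding spin_diff_def by auto
  from this[OF yi zi] have "\<bar>g ?z - g z\<bar> \<le> 2 * \<delta> i" by simp
  then show ?case using 1 insert.hyps by simp
qed

text \<open>\<open>c\<close> dominates Dobrushin's interdependence matrix, and
  \<open>\<beta>\<close> bounds the conditional variance of every spin from below. Both bounds are
  uniform over configurations, so that they survive further conditioning.\<close>

locale dobrushin =
  fixes S :: "'i set" and x :: "'i \<Rightarrow> real" and w :: "('i \<Rightarrow> real) \<Rightarrow> real"
    and c :: "'i \<Rightarrow> 'i \<Rightarrow> real" and \<alpha> \<beta> :: real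
  assumes fin: "finite S" and w_pos: "\<And>y. 0 < w y"
    and alpha_pos: "0 < \<alpha>" and alpha_le: "\<alpha> \<le> 1" and beta_pos: "0 < \<beta>"
    and mag_bound: "\<And>i y. i \<in> S \<Longrightarrow> y \<in> cfg S x \<Longrightarrow> \<beta> \<le> 1 - (mag w i y)\<^sup>2"
    and influence: "\<And>i j y. i \<in> S \<Longrightarrow> j \<in> S \<Longrightarrow> i \<noteq> j \<Longrightarrow> y \<in> cfg S x \<Longrightarrow>
      \<bar>spin_diff j (mag w i) y\<bar> \<le> c i j"
    and c_nonneg: "\<And>i j. 0 \<le> c i j"
    and c_sym: "\<And>i j. i \<in> S \<Longrightarrow> j \<in> S \<Longrightarrow> c i j = c j i"
    and c_row: "\<And>i. i \<in> S \<Longrightarrow> (\<Sum>j\<in>S. c i j) \<le> 1 - \<alpha>"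
begin

lemma mag_less: "i \<in> S \<Longrightarrow> y \<in> cfg S x \<Longrightarrow> \<bar>mag w i y\<bar> < 1"
  using mag_bound[of i y] beta_pos by (simp add: abs_square_less_1[symmetric])

lemma spin_diff_cE_self: "spin_diff k (cE w {k} g) y = 0"
  unfolding spin_diff_def by (simp add: cE_single[OF w_pos])

text \<open>A discrete product rule: flipping j changes the integrand, which contributes an average
  of slopes in direction j, and it changes the law of spin k, which contributes the shift of its
  mean times the slope in direction k.\<close>

lemma spin_diff_cE_le:
  assumes k: "k \<in> S" and j: "j \<in> S" "j \<noteq> k" and y: "y \<in> cfg S x"
    and \<delta>: "\<And>j u. j \<in> S \<Longrightarrow> u \<in> cfg S x \<Longrightarrow> \<bar>spin_diff j g u\<bar> \<le> \<delta> j"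
  shows "\<bar>spin_diff j (cE w {k} g) y\<bar> \<le> \<delta> j + c k j * \<delta> k"
proof -
  let ?u = "y(j := 1)" and ?v = "y(j := -1)"
  have uv: "?u \<in> cfg S x" "?v \<in> cfg S x"
    using y j by (auto intro: cfg_upd)
  have k': "y(k := 1) \<in> cfg S x" "y(k := -1) \<in> cfg S x"
    using y k by (auto intro: cfg_upd)
  let ?p = "(1 + mag w k ?u) / 2" and ?q = "(1 - mag w k ?u) / 2"
  let ?a = "spin_diff j g (y(k := 1))" and ?b = "spin_diff j g (y(k := -1))"
  have pq: "0 \<le> ?p" "0 \<le> ?q" using mag_less[OF k uv(1)] by auto
  have tw: "y(j := s, k := t) = y(k := t, j := s)" for s t
    using j by (simp add: fun_upd_twist)
  have eq: "spin_diff j (cE w {k} g) y = ?p * ?a + ?q * ?b + spin_diff j (mag w k) y * spin_diff k g ?v"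
    unfolding spin_diff_def cE_single[OF w_pos] tw by (simp add: field_simps)
  have "\<bar>spin_diff j (cE w {k} g) y\<bar>
      \<le> ?p * \<bar>?a\<bar> + ?q * \<bar>?b\<bar> + \<bar>spin_diff j (mag w k) y\<bar> * \<bar>spin_diff k g ?v\<bar>"
    unfolding eq using pq by (simp add: abs_mult[symmetric] abs_mult_pos')
  also have "\<dots> \<le> ?p * \<delta> j + ?q * \<delta> j + c k j * \<delta> k"
    using pq \<delta>[OF j(1) k'(1)] \<delta>[OF j(1) k'(2)] \<delta>[OF k uv(2)] influence[OF k j(1) _ y] j(2) c_nonneg
    by (intro add_mono mult_left_mono mult_mono) auto
  also have "\<dots> = \<delta> j + c k j * \<delta> k"
    by (simp add: field_simps)
  finally show ?thesis .
qed

section \<open>Comparison of a tilted measure with the original one\<close>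

context
  fixes f :: "('i \<Rightarrow> real) \<Rightarrow> real"
  assumes f_pos: "\<And>y. y \<in> cfg S x \<Longrightarrow> 0 < f y"
begin

definition tilt :: "(('i \<Rightarrow> real) \<Rightarrow> real) \<Rightarrow> real" where
  "tilt g = cE w S (\<lambda>y. f y * g y) x / cE w S f x"

text \<open>A vector is a comparison vector if it bounds the distance of the tilted measure to the
  original one on functions with given oscillations, as in Dobrushin's comparison theorem.\<close>

definition comparison :: "('i \<Rightarrow> real) \<Rightarrow> bool" where
  "comparison a \<longleftrightarrow> (\<forall>j\<in>S. 0 \<le> a j) \<and> (\<forall>g \<delta>.
     (\<forall>j\<in>S. \<forall>u\<in>cfg S x. \<bar>spin_diff j g u\<bar> \<le> \<delta> j) \<longrightarrow>
     \<bar>tilt g - cE w S g x\<bar> \<le> (\<Sum>j\<in>S. a j * \<delta> j))"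

lemma comparisonD:
  assumes "comparison a" "\<And>j u. j \<in> S \<Longrightarrow> u \<in> cfg S x \<Longrightarrow> \<bar>spin_diff j g u\<bar> \<le> \<delta> j"
  shows "\<bar>tilt g - cE w S g x\<bar> \<le> (\<Sum>j\<in>S. a j * \<delta> j)"
  using assms by (auto simp: comparison_def)

lemma cE_f_pos: "0 < cE w S f x"
  using f_pos by (intro cE_pos[OF w_pos] fin)

lemma cE_single_f_pos: "i \<in> S \<Longrightarrow> y \<in> cfg S x \<Longrightarrow> 0 < cE w {i} f y"
  using f_pos cfg_subset[of "{i}" S y x] by (intro cE_pos[OF w_pos]) auto

lemma tilt_diff: "tilt (\<lambda>y. g y - h y) = tilt g - tilt h"
  by (simp add: tilt_def right_diff_distrib cE_diff[OF w_pos] diff_divide_distrib)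

lemma tilt_mono:
  assumes "\<And>y. y \<in> cfg S x \<Longrightarrow> g y \<le> h y"
  shows "tilt g \<le> tilt h"
  unfolding tilt_def using assms cE_f_pos f_pos
  by (intro divide_right_mono cE_mono[OF w_pos] fin mult_left_mono) (auto intro: less_imp_le)

lemma tilt_const: "tilt (\<lambda>y. k) = k"
  using cE_f_pos by (simp add: tilt_def cE_cmult_right[OF w_pos])

lemma tilt_cmult: "tilt (\<lambda>y. k * g y) = k * tilt g"
  by (simp add: tilt_def mult.left_commute[of _ k] cE_cmult[OF w_pos])

lemma tilt_abs_le: "\<bar>tilt g\<bar> \<le> tilt (\<lambda>y. \<bar>g y\<bar>)"
proof -
  have "tilt g \<le> tilt (\<lambda>y. \<bar>g y\<bar>)" by (intro tilt_mono) auto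
  moreover have "tilt (\<lambda>y. (-1) * g y) \<le> tilt (\<lambda>y. \<bar>g y\<bar>)" by (intro tilt_mono) auto
  ultimately show ?thesis unfolding tilt_cmult by auto
qed

lemma tilt_square_le: "(tilt g)\<^sup>2 \<le> tilt (\<lambda>y. (g y)\<^sup>2)"
proof -
  have "0 = tilt (\<lambda>y. 0)" by (simp add: tilt_const)
  also have "\<dots> \<le> tilt (\<lambda>y. (g y - tilt g)\<^sup>2)" by (rule tilt_mono) simp
  also have "(\<lambda>y. (g y - tilt g)\<^sup>2) = (\<lambda>y. (g y)\<^sup>2 - (2 * tilt g * g y - (tilt g)\<^sup>2))"
    by (auto simp: power2_eq_square algebra_simps)
  also have "tilt \<dots> = tilt (\<lambda>y. (g y)\<^sup>2) - (tilt g)\<^sup>2"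
    unfolding tilt_diff tilt_cmult tilt_const by (simp add: power2_eq_square)
  finally show ?thesis by simp
qed

text \<open>With the other spins fixed, g is affine in spin k with slope
  \<open>spin_diff k g\<close>. Its conditional means under the tilted and the original law
  therefore differ by this slope times the shift of the mean of spin k.\<close>

lemma tilt_resample:
  assumes k: "k \<in> S"
  shows "tilt g - tilt (cE w {k} g) = tilt (\<lambda>y. spin_diff k g y * local_bias w k f y)"
proof -
  have "cE w S (\<lambda>y. f y * (g y - cE w {k} g y)) x = cE w S (\<lambda>y. f y * (spin_diff k g y * local_bias w k f y)) x"
    (is "cE w S ?F x = cE w S ?G x")
  proof -
    have "cE w {k} ?F y = cE w {k} ?G y" if y: "y \<in> cfg S x" for y
    proof -
      have pos: "0 < cE w {k} f y" using cE_single_f_pos[OF k y] .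
      let ?m = "mag w k y"
      have b: "local_bias w k f (y(k := s)) = local_bias w k f y" for s
        by (simp add: local_bias_def cE_single[OF w_pos])
      have "local_bias w k f y * cE w {k} f y
          = cE w {k} (\<lambda>z. f z * z k) y - ?m * cE w {k} f y"
        using pos by (simp add: local_bias_def field_simps)
      also have "\<dots> = (1 - ?m\<^sup>2) / 2 * (f (y(k := 1)) - f (y(k := -1)))"
        by (simp add: cE_single[OF w_pos] field_simps power2_eq_square)
      finally have lb: "local_bias w k f y * cE w {k} f y
        = (1 - ?m\<^sup>2) / 2 * (f (y(k := 1)) - f (y(k := -1)))" .
      have "cE w {k} ?G y = spin_diff k g y * (local_bias w k f y * cE w {k} f y)"
        by (simp add: cE_single[OF w_pos] b algebra_simps)
      also have "\<dots> = cE w {k} ?F y"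
        unfolding lb by (simp add: cE_single[OF w_pos] spin_diff_def field_simps power2_eq_square)
      finally show ?thesis by simp
    qed
    then have "cE w S (cE w {k} ?F) x = cE w S (cE w {k} ?G) x"
      by (rule cE_cong[OF w_pos])
    then show ?thesis using cE_tower[OF w_pos fin, of "{k}"] k by simp
  qed
  then show ?thesis by (simp add: tilt_diff[symmetric]) (simp add: tilt_def)
qed

text \<open>Starting point of the iteration: two means of g differ by at most the total oscillation
  of g.\<close>

lemma comparison_const: "comparison (\<lambda>_. 2)"
  unfolding comparison_def
proof (intro conjI ballI allI impI)
  fix g \<delta> assume \<delta>: "\<forall>j\<in>S. \<forall>u\<in>cfg S x. \<bar>spin_diff j g u\<bar> \<le> \<delta> j"
  let ?e = "cE w S g x" and ?R = "\<Sum>j\<in>S. 2 * \<delta> j"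
  have "\<bar>g y - ?e\<bar> \<le> ?R" if y: "y \<in> cfg S x" for y
  proof -
    have "g y - ?e = cE w S (\<lambda>z. g y - g z) x"
      by (simp add: cE_diff[OF w_pos] cE_const[OF w_pos fin])
    also have "\<bar>\<dots>\<bar> \<le> cE w S (\<lambda>z. \<bar>g y - g z\<bar>) x"
      by (rule cE_abs_le[OF w_pos fin])
    also have "\<dots> \<le> cE w S (\<lambda>z. ?R) x"
      using oscillation_le[OF fin y] \<delta>
      by (intro cE_mono[OF w_pos fin]) (simp add: sum_distrib_left)
    finally show ?thesis by (simp add: cE_const[OF w_pos fin])
  qed
  then have "tilt (\<lambda>y. \<bar>g y - ?e\<bar>) \<le> tilt (\<lambda>_. ?R)"
    by (rule tilt_mono)
  moreover have "\<bar>tilt g - ?e\<bar> \<le> tilt (\<lambda>y. \<bar>g y - ?e\<bar>)"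
    using tilt_abs_le[of "\<lambda>y. g y - ?e"] by (simp add: tilt_diff tilt_const)
  ultimately show "\<bar>tilt g - ?e\<bar> \<le> ?R"
    by (simp add: tilt_const)
qed simp

text \<open>The comparison is applied to \<open>cE w {k} g\<close> in place of g. Resampling spin k
  preserves the mean under w, moves the tilted mean by the local bias, and removes the oscillation
  at k at the price of adding \<open>c k j * \<delta> k\<close> at every other j. In effect, the
  entry \<open>a k\<close> is replaced by the bias plus
  \<open>(\<Sum>j\<in>S. c k j * a j)\<close>.\<close>

lemma comparison_update:
  assumes a: "comparison a" and k: "k \<in> S"
    and \<delta>: "\<And>j u. j \<in> S \<Longrightarrow> u \<in> cfg S x \<Longrightarrow> \<bar>spin_diff j g u\<bar> \<le> \<delta> j"
  shows "\<bar>tilt g - cE w S g x\<bar> \<le> (\<Sum>j\<in>S. a j * \<delta> j)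
    + (tilt (\<lambda>y. \<bar>local_bias w k f y\<bar>) + (\<Sum>j\<in>S. c k j * a j) - a k) * \<delta> k"
proof -
  let ?G = "cE w {k} g" and ?b = "local_bias w k f"
  let ?\<delta> = "\<lambda>j. if j = k then 0 else \<delta> j + c k j * \<delta> k"
  have a0: "0 \<le> a j" if "j \<in> S" for j using a that by (simp add: comparison_def)
  obtain u where u: "u \<in> cfg S x" using cfg_nonempty by blast
  have \<delta>k: "0 \<le> \<delta> k" using \<delta>[OF k u] by linarith
  have "\<bar>spin_diff j ?G u\<bar> \<le> ?\<delta> j" if "j \<in> S" "u \<in> cfg S x" for j u
  proof (cases "j = k")
    case False
    then show ?thesis using spin_diff_cE_le[OF k that(1) False that(2) \<delta>] by simp
  qed (simp add: spin_diff_cE_self)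
  then have 1: "\<bar>tilt ?G - cE w S ?G x\<bar> \<le> (\<Sum>j\<in>S. a j * ?\<delta> j)"
    by (intro comparisonD[OF a])
  have 2: "cE w S ?G x = cE w S g x"
    using cE_tower[OF w_pos fin, of "{k}"] k by simp
  have "\<bar>tilt g - tilt ?G\<bar> \<le> tilt (\<lambda>y. \<bar>spin_diff k g y * ?b y\<bar>)"
    unfolding tilt_resample[OF k] by (rule tilt_abs_le)
  also have "\<dots> \<le> tilt (\<lambda>y. \<delta> k * \<bar>?b y\<bar>)"
    using \<delta>[OF k] by (intro tilt_mono) (simp add: abs_mult mult_right_mono)
  finally have 3: "\<bar>tilt g - tilt ?G\<bar> \<le> \<delta> k * tilt (\<lambda>y. \<bar>?b y\<bar>)"
    by (simp add: tilt_cmult)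
  have "(\<Sum>j\<in>S. a j * ?\<delta> j) = (\<Sum>j\<in>S - {k}. a j * (\<delta> j + c k j * \<delta> k))"
    using fin k by (subst sum.remove[of _ k]) (auto intro: sum.cong)
  also have "\<dots> = (\<Sum>j\<in>S - {k}. a j * \<delta> j) + (\<Sum>j\<in>S - {k}. c k j * a j) * \<delta> k"
    by (simp add: algebra_simps sum.distrib sum_distrib_left)
  also have "\<dots> \<le> (\<Sum>j\<in>S - {k}. a j * \<delta> j) + (\<Sum>j\<in>S. c k j * a j) * \<delta> k"
    using fin \<delta>k c_nonneg a0 by (intro add_left_mono mult_right_mono sum_mono2) auto
  also have "(\<Sum>j\<in>S - {k}. a j * \<delta> j) = (\<Sum>j\<in>S. a j * \<delta> j) - a k * \<delta> k"
    using fin k by (simp add: sum.remove)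
  finally show ?thesis using 1 2 3 by (simp add: algebra_simps)
qed

text \<open>One update improves a single entry only. Averaging the bounds over a uniform k acts on
  all entries by one affine map, whose linear part (1 - r) + r c contracts in the l2 norm.\<close>

lemma comparison_average:
  assumes a: "comparison a" and ne: "S \<noteq> {}"
  defines "r \<equiv> 1 / real (card S)"
  shows "comparison (\<lambda>k. (1 - r) * a k
    + r * (tilt (\<lambda>y. \<bar>local_bias w k f y\<bar>) + (\<Sum>j\<in>S. c k j * a j)))"
  unfolding comparison_def
proof (intro conjI ballI allI impI)
  have card: "card S \<ge> 1" using ne fin by (simp add: Suc_le_eq card_gt_0_iff)
  then have r: "0 < r" "r \<le> 1" "r * real (card S) = 1" by (auto simp: r_def)
  have a0: "0 \<le> a j" if "j \<in> S" for j using a that by (simp add: comparison_def)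
  let ?B = "\<lambda>k. tilt (\<lambda>y. \<bar>local_bias w k f y\<bar>) + (\<Sum>j\<in>S. c k j * a j)"
  have "tilt (\<lambda>y. 0) \<le> tilt (\<lambda>y. \<bar>local_bias w k f y\<bar>)" for k
    by (rule tilt_mono) simp
  then have B: "0 \<le> ?B k" for k
    using a0 c_nonneg by (auto simp: tilt_const intro!: add_nonneg_nonneg sum_nonneg)
  show "0 \<le> (1 - r) * a j + r * ?B j" if "j \<in> S" for j
    using r a0[OF that] B[of j] by auto
  fix g \<delta> assume \<delta>: "\<forall>j\<in>S. \<forall>u\<in>cfg S x. \<bar>spin_diff j g u\<bar> \<le> \<delta> j"
  let ?L = "\<bar>tilt g - cE w S g x\<bar>" and ?A = "\<Sum>j\<in>S. a j * \<delta> j"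
  have "real (card S) * ?L = (\<Sum>k\<in>S. ?L)" by simp
  also have "\<dots> \<le> (\<Sum>k\<in>S. ?A + (?B k - a k) * \<delta> k)"
    using comparison_update[OF a, of _ g \<delta>] \<delta> by (intro sum_mono) auto
  also have "\<dots> = real (card S) * ?A + (\<Sum>k\<in>S. (?B k - a k) * \<delta> k)"
    by (simp add: sum.distrib)
  finally have "r * (real (card S) * ?L) \<le> r * (real (card S) * ?A + (\<Sum>k\<in>S. (?B k - a k) * \<delta> k))"
    using r by (intro mult_left_mono) auto
  also have "\<dots> = (r * real (card S)) * ?A + r * (\<Sum>k\<in>S. (?B k - a k) * \<delta> k)"
    by (simp add: algebra_simps)
  also have "\<dots> = ?A + (\<Sum>k\<in>S. r * ((?B k - a k) * \<delta> k))"
    by (simp add: r(3) sum_distrib_left)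
  also have "\<dots> = (\<Sum>k\<in>S. ((1 - r) * a k + r * ?B k) * \<delta> k)"
    unfolding sum.distrib[symmetric] by (intro sum.cong refl) (simp add: algebra_simps)
  also have "r * (real (card S) * ?L) = ?L"
    using r(3) by (simp add: mult.assoc[symmetric])
  finally show "?L \<le> (\<Sum>k\<in>S. ((1 - r) * a k + r * ?B k) * \<delta> k)" .
qed

end

end

section \<open>Approximate tensorization of entropy\<close>

text \<open>Schur's test: Cauchy-Schwarz with weights \<open>c i j\<close>, where the row sums bound
  one factor and, after exchanging the sums, the column sums bound the other.\<close>

lemma L2_set_matrix_le:
  fixes c :: "'i \<Rightarrow> 'i \<Rightarrow> real"
  assumes "0 \<le> r" "\<And>i j. i \<in> S \<Longrightarrow> j \<in> S \<Longrightarrow> 0 \<le> c i j"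
    and row: "\<And>i. i \<in> S \<Longrightarrow> (\<Sum>j\<in>S. c i j) \<le> r" and col: "\<And>j. j \<in> S \<Longrightarrow> (\<Sum>i\<in>S. c i j) \<le> r"
  shows "L2_set (\<lambda>i. \<Sum>j\<in>S. c i j * a j) S \<le> r * L2_set a S"
proof -
  have "(\<Sum>j\<in>S. c i j * a j)\<^sup>2 \<le> r * (\<Sum>j\<in>S. c i j * (a j)\<^sup>2)" if i: "i \<in> S" for i
  proof -
    have "(\<Sum>j\<in>S. c i j * a j)\<^sup>2 = (\<Sum>j\<in>S. sqrt (c i j) * (sqrt (c i j) * a j))\<^sup>2"
      using assms(2)[OF i] by (simp add: mult.assoc[symmetric])
    also have "\<dots> \<le> (\<Sum>j\<in>S. (sqrt (c i j))\<^sup>2) * (\<Sum>j\<in>S. (sqrt (c i j) * a j)\<^sup>2)"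
      by (rule Cauchy_Schwarz_ineq_sum)
    also have "\<dots> = (\<Sum>j\<in>S. c i j) * (\<Sum>j\<in>S. c i j * (a j)\<^sup>2)"
      using assms(2)[OF i] by (simp add: power_mult_distrib)
    also have "\<dots> \<le> r * (\<Sum>j\<in>S. c i j * (a j)\<^sup>2)"
      using row[OF i] assms(2)[OF i] by (intro mult_right_mono sum_nonneg) auto
    finally show ?thesis .
  qed
  then have "(\<Sum>i\<in>S. (\<Sum>j\<in>S. c i j * a j)\<^sup>2) \<le> (\<Sum>i\<in>S. r * (\<Sum>j\<in>S. c i j * (a j)\<^sup>2))"
    by (rule sum_mono)
  also have "\<dots> = r * (\<Sum>i\<in>S. \<Sum>j\<in>S. c i j * (a j)\<^sup>2)"
    by (simp only: sum_distrib_left)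
  also have "\<dots> = r * (\<Sum>j\<in>S. (\<Sum>i\<in>S. c i j) * (a j)\<^sup>2)"
    unfolding sum_distrib_right by (subst sum.swap) (rule refl)
  also have "\<dots> \<le> r * (\<Sum>j\<in>S. r * (a j)\<^sup>2)"
    using assms(1) col by (intro mult_left_mono sum_mono mult_right_mono) auto
  also have "\<dots> = (r * L2_set a S)\<^sup>2"
    by (simp add: L2_set_def power_mult_distrib sum_nonneg power2_eq_square[of r] sum_distrib_left mult.assoc)
  finally show ?thesis
    using assms(1) unfolding L2_set_def by (intro real_le_lsqrt) (simp_all add: sum_nonneg)
qed

context dobrushin
begin

text \<open>Freezing spins restricts the configurations and drops nonnegative terms from the row
  sums, so no constant deteriorates in an induction on the number of spins.\<close>

lemma dobrushin_subset:
  assumes "T \<subseteq> S" "y \<in> cfg S x"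
  shows "dobrushin T y w c \<alpha> \<beta>"
proof
  have sub: "cfg T y \<subseteq> cfg S x" using cfg_subset[OF assms] .
  show "finite T" using fin assms(1) by (rule rev_finite_subset)
  show "(\<Sum>j\<in>T. c i j) \<le> 1 - \<alpha>" if "i \<in> T" for i
  proof -
    have "(\<Sum>j\<in>T. c i j) \<le> (\<Sum>j\<in>S. c i j)"
      using assms fin c_nonneg by (intro sum_mono2) auto
    also have "\<dots> \<le> 1 - \<alpha>" using that assms by (intro c_row) auto
    finally show ?thesis .
  qed
qed (use assms cfg_subset[OF assms] w_pos alpha_pos alpha_le beta_pos mag_bound influence c_nonneg c_sym in \<open>auto simp: subset_iff\<close>)

context
  fixes f :: "('i \<Rightarrow> real) \<Rightarrow> real"
  assumes f_pos: "\<And>y. y \<in> cfg S x \<Longrightarrow> 0 < f y"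
begin

text \<open>The averaged updates are iterated from the constant vector 2. Each one contracts the l2
  norm by 1 - r \<alpha> and adds r B, so the contribution of the initial vector dies out and the
  fixed point B / \<alpha> remains.\<close>

lemma tilt_marginals:
  "(\<Sum>i\<in>S. (tilt f (\<lambda>y. y i) - cE w S (\<lambda>y. y i) x)\<^sup>2)
    \<le> (\<Sum>i\<in>S. tilt f (\<lambda>y. (local_bias w i f y)\<^sup>2)) / \<alpha>\<^sup>2"
proof (cases "S = {}")
  case False
  define r where "r = 1 / real (card S)"
  have "card S \<ge> 1" using False fin by (simp add: Suc_le_eq card_gt_0_iff)
  then have r: "0 < r" "r \<le> 1" by (auto simp: r_def)
  define b where "b k = tilt f (\<lambda>y. \<bar>local_bias w k f y\<bar>)" for k
  define B where "B = L2_set b S"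
  define stp where "stp a k = (1 - r) * a k + r * (b k + (\<Sum>j\<in>S. c k j * a j))" for a k
  define a where "a t = (stp ^^ t) (\<lambda>_. 2)" for t
  have Suc: "a (Suc t) = stp (a t)" for t by (simp add: a_def)
  have comp: "comparison f (a t)" for t
  proof (induction t)
    case 0
    then show ?case using comparison_const[OF f_pos] by (simp add: a_def)
  next
    case (Suc t)
    have "comparison f (stp (a t))"
      using comparison_average[OF f_pos Suc False] unfolding stp_def b_def r_def .
    then show ?case by (simp add: \<open>\<And>t. a (Suc t) = stp (a t)\<close>)
  qed
  have col: "(\<Sum>i\<in>S. c i j) \<le> 1 - \<alpha>" if "j \<in> S" for j
    using c_row[OF that] c_sym[OF that] by (metis (no_types, lifting) sum.cong)
  have step: "L2_set (a (Suc t)) S \<le> (1 - r * \<alpha>) * L2_set (a t) S + r * B" for t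
  proof -
    have "L2_set (a (Suc t)) S \<le> L2_set (\<lambda>k. (1 - r) * a t k) S
        + L2_set (\<lambda>k. r * (b k + (\<Sum>j\<in>S. c k j * a t j))) S"
      unfolding Suc stp_def by (rule L2_set_triangle_ineq)
    also have "\<dots> = (1 - r) * L2_set (a t) S + r * L2_set (\<lambda>k. b k + (\<Sum>j\<in>S. c k j * a t j)) S"
      using r by (simp add: L2_set_right_distrib)
    also have "\<dots> \<le> (1 - r) * L2_set (a t) S + r * (B + (1 - \<alpha>) * L2_set (a t) S)"
      unfolding B_def using r alpha_le c_nonneg c_row col
      by (intro add_left_mono mult_left_mono order_trans[OF L2_set_triangle_ineq] L2_set_matrix_le) auto
    finally show ?thesis by (simp add: algebra_simps)
  qed
  have q: "0 \<le> 1 - r * \<alpha>" "1 - r * \<alpha> < 1"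
    using r alpha_le alpha_pos by (auto intro: mult_le_one)
  have bound: "L2_set (a t) S \<le> (1 - r * \<alpha>) ^ t * L2_set (a 0) S + B / \<alpha>" for t
  proof (induction t)
    case 0
    then show ?case using alpha_pos by (simp add: B_def)
  next
    case (Suc t)
    have "L2_set (a (Suc t)) S \<le> (1 - r * \<alpha>) * L2_set (a t) S + r * B" by (rule step)
    also have "\<dots> \<le> (1 - r * \<alpha>) * ((1 - r * \<alpha>) ^ t * L2_set (a 0) S + B / \<alpha>) + r * B"
      using q Suc by (intro add_right_mono mult_left_mono) auto
    also have "\<dots> = (1 - r * \<alpha>) ^ Suc t * L2_set (a 0) S + B / \<alpha>"
      using alpha_pos by (simp add: field_simps)
    finally show ?case .
  qed
  let ?e = "\<lambda>i. tilt f (\<lambda>y. y i) - cE w S (\<lambda>y. y i) x"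
  have marg: "\<bar>?e i\<bar> \<le> a t i" if i: "i \<in> S" for i t
  proof -
    \<comment> \<open>The function compared is the i-th coordinate, whose oscillation vector is the
      i-th unit vector; this isolates one entry of the comparison vector.\<close>
    have "\<bar>?e i\<bar> \<le> (\<Sum>j\<in>S. a t j * (if j = i then 1 else 0))"
      by (rule comparisonD[OF f_pos comp]) (auto simp: spin_diff_def)
    also have "\<dots> = a t i"
      using fin i by (simp add: if_distrib[of "\<lambda>z. _ * z"] sum.delta cong: if_cong)
    finally show ?thesis .
  qed
  have le: "L2_set (\<lambda>i. \<bar>?e i\<bar>) S \<le> (1 - r * \<alpha>) ^ t * L2_set (a 0) S + B / \<alpha>" for t
    by (rule order_trans[OF L2_set_mono bound]) (use marg in auto)
  have "(\<lambda>t. (1 - r * \<alpha>) ^ t * L2_set (a 0) S + B / \<alpha>) \<longlonglongrightarrow> 0 * L2_set (a 0) S + B / \<alpha>"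
    using q by (intro tendsto_intros LIMSEQ_power_zero) auto
  then have "L2_set (\<lambda>i. \<bar>?e i\<bar>) S \<le> B / \<alpha>"
    using le by (intro LIMSEQ_le_const[of _ "B / \<alpha>"]) auto
  then have "(L2_set (\<lambda>i. \<bar>?e i\<bar>) S)\<^sup>2 \<le> (B / \<alpha>)\<^sup>2"
    by (intro power_mono) auto
  then have "(\<Sum>i\<in>S. (?e i)\<^sup>2) \<le> (\<Sum>i\<in>S. (b i)\<^sup>2) / \<alpha>\<^sup>2"
    by (simp add: L2_set_def B_def sum_nonneg power_divide)
  also have "\<dots> \<le> (\<Sum>i\<in>S. tilt f (\<lambda>y. (local_bias w i f y)\<^sup>2)) / \<alpha>\<^sup>2"
    unfolding b_def using tilt_square_le[OF f_pos, where g = "\<lambda>y. \<bar>local_bias w i f y\<bar>" for i]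
    by (intro divide_right_mono sum_mono) auto
  finally show ?thesis .
qed simp

end

end

section \<open>Entropy, its chain rule, and single-spin marginals\<close>

definition entropy ::
  "(('i \<Rightarrow> real) \<Rightarrow> real) \<Rightarrow> 'i set \<Rightarrow> (('i \<Rightarrow> real) \<Rightarrow> real) \<Rightarrow> ('i \<Rightarrow> real) \<Rightarrow> real" where
  "entropy w S f x = cE w S (\<lambda>y. f y * ln (f y)) x - cE w S f x * ln (cE w S f x)"

context dobrushin
begin

text \<open>\<open>cE w T f\<close> is the density of the marginal on the spins in S - T; the second
  summand is the entropy of that marginal, the first the mean conditional entropy.\<close>

lemma entropy_chain:
  assumes "T \<subseteq> S"
  shows "entropy w S f x = cE w S (entropy w T f) x + entropy w S (cE w T f) x"
proof -
  have eta: "entropy w T f = (\<lambda>y. cE w T (\<lambda>y. f y * ln (f y)) y - cE w T f y * ln (cE w T f y))"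
    by (auto simp: entropy_def)
  have "cE w S (entropy w T f) x
    = cE w S (cE w T (\<lambda>y. f y * ln (f y))) x - cE w S (\<lambda>y. cE w T f y * ln (cE w T f y)) x"
    unfolding eta by (rule cE_diff[OF w_pos])
  then show ?thesis
    by (simp add: entropy_def cE_tower[OF w_pos fin assms])
qed

text \<open>The bound ln u \<le> u - 1 at u = f / E f, integrated against f.\<close>

lemma entropy_le_chi_square:
  assumes f_pos: "\<And>y. y \<in> cfg S x \<Longrightarrow> 0 < f y"
  shows "entropy w S f x \<le> cE w S (\<lambda>y. (f y)\<^sup>2) x / cE w S f x - cE w S f x"
proof -
  let ?e = "cE w S f x"
  have e: "0 < ?e" using cE_pos[OF w_pos fin f_pos] .
  have "entropy w S f x = cE w S (\<lambda>y. f y * ln (f y) - f y * ln ?e) x"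
    by (simp add: entropy_def cE_diff[OF w_pos] cE_cmult_right[OF w_pos])
  also have "\<dots> \<le> cE w S (\<lambda>y. (f y)\<^sup>2 * (1 / ?e) - f y) x"
  proof (rule cE_mono[OF w_pos fin])
    fix y assume "y \<in> cfg S x"
    then have f: "0 < f y" by (rule f_pos)
    have "ln (f y / ?e) \<le> f y / ?e - 1" using f e by (intro ln_le_minus_one) simp
    then have "f y * ln (f y / ?e) \<le> f y * (f y / ?e - 1)"
      using f by (intro mult_left_mono) auto
    then show "f y * ln (f y) - f y * ln ?e \<le> (f y)\<^sup>2 * (1 / ?e) - f y"
      using f e by (simp add: ln_div algebra_simps power2_eq_square)
  qed
  also have "\<dots> = cE w S (\<lambda>y. (f y)\<^sup>2) x / ?e - ?e"
    unfolding cE_diff[OF w_pos] cE_cmult_right[OF w_pos] by simp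
  finally show ?thesis .
qed

text \<open>The marginal density of one spin is affine, p + q \<open>y i\<close>, so its chi-square
  divergence is exactly the squared shift of the mean divided by the variance of the spin. That
  variance is at least \<beta>: the mean is an average of conditional means, and Jensen's inequality
  applies to its square.\<close>

lemma entropy_marginal_le:
  assumes f_pos: "\<And>y. y \<in> cfg S x \<Longrightarrow> 0 < f y" and i: "i \<in> S"
  shows "entropy w S (cE w (S - {i}) f) x
    \<le> cE w S f x * (tilt f (\<lambda>y. y i) - cE w S (\<lambda>y. y i) x)\<^sup>2 / \<beta>"
proof -
  let ?T = "S - {i}"
  let ?h = "cE w ?T f" and ?E = "\<lambda>g. cE w S g x"
  let ?M = "?E (\<lambda>y. y i)" and ?e = "?E f"
  define p where "p = (?h (x(i := 1)) + ?h (x(i := -1))) / 2"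
  define q where "q = (?h (x(i := 1)) - ?h (x(i := -1))) / 2"
  have e: "0 < ?e" using cE_pos[OF w_pos fin f_pos] .
  have h: "?h y = p + q * y i" if y: "y \<in> cfg S x" for y
  proof -
    have "?h y = ?h (x(i := y i))"
      using y by (intro cE_cfg_cong[OF w_pos order_refl]) (auto simp: cfg_def)
    then show ?thesis using cfg_spin[OF y i] by (auto simp: p_def q_def field_simps)
  qed
  have h_pos: "0 < ?h y" if y: "y \<in> cfg S x" for y
    using f_pos cfg_subset[OF _ y, of ?T] fin by (intro cE_pos[OF w_pos]) auto
  have sq: "(y i)\<^sup>2 = 1" if "y \<in> cfg S x" for y
    using cfg_spin[OF that i] by auto
  have e_h: "?e = ?E ?h" by (simp add: cE_tower[OF w_pos fin])
  have "?E ?h = ?E (\<lambda>y. p + q * y i)" by (rule cE_cong[OF w_pos h])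
  then have e_pq: "?e = p + q * ?M"
    unfolding e_h by (simp add: cE_add[OF w_pos] cE_const[OF w_pos fin] cE_cmult[OF w_pos])
  have "?E (\<lambda>y. (?h y)\<^sup>2) = ?E (\<lambda>y. (p\<^sup>2 + q\<^sup>2) + (2 * p * q) * y i)"
    by (rule cE_cong[OF w_pos]) (simp add: h sq power2_sum power_mult_distrib)
  then have h2: "?E (\<lambda>y. (?h y)\<^sup>2) = p\<^sup>2 + q\<^sup>2 + 2 * p * q * ?M"
    by (simp add: cE_add[OF w_pos] cE_const[OF w_pos fin] cE_cmult[OF w_pos])
  have "?E (\<lambda>y. f y * y i) = ?E (cE w ?T (\<lambda>y. f y * y i))"
    by (simp add: cE_tower[OF w_pos fin])
  also have "\<dots> = ?E (\<lambda>y. y i * ?h y)"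
  proof (rule cE_cong[OF w_pos])
    fix y
    have "cE w ?T (\<lambda>z. z i * f z) y = y i * ?h y"
      by (rule cE_pull_out[OF w_pos]) (auto simp: cfg_def)
    then show "cE w ?T (\<lambda>z. f z * z i) y = y i * ?h y" by (simp add: mult.commute)
  qed
  also have "\<dots> = ?E (\<lambda>y. p * y i + q)"
    by (rule cE_cong[OF w_pos]) (use sq in \<open>simp add: h algebra_simps power2_eq_square\<close>)
  also have "\<dots> = p * ?M + q"
    by (simp add: cE_add[OF w_pos] cE_const[OF w_pos fin] cE_cmult[OF w_pos])
  finally have "tilt f (\<lambda>y. y i) = (p * ?M + q) / ?e"
    by (simp add: tilt_def[OF f_pos])
  then have t: "?e * (tilt f (\<lambda>y. y i) - ?M) = q * (1 - ?M\<^sup>2)"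
    using e by (simp add: field_simps) (simp add: e_pq power2_eq_square algebra_simps)
  have M: "\<beta> \<le> 1 - ?M\<^sup>2"
  proof -
    have "?M = ?E (mag w i)"
      unfolding mag_def using i by (simp add: cE_tower[OF w_pos fin])
    then have "?M\<^sup>2 \<le> ?E (\<lambda>y. (mag w i y)\<^sup>2)"
      using cE_square_le[OF w_pos fin] by simp
    also have "\<dots> \<le> ?E (\<lambda>y. 1 - \<beta>)"
      using mag_bound[OF i] by (intro cE_mono[OF w_pos fin]) force
    finally show ?thesis by (simp add: cE_const[OF w_pos fin])
  qed
  have "entropy w S ?h x \<le> ?E (\<lambda>y. (?h y)\<^sup>2) / ?e - ?e"
    using entropy_le_chi_square[OF h_pos] unfolding e_h by simp
  also have "\<dots> = q\<^sup>2 * (1 - ?M\<^sup>2) / ?e"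
    using e unfolding h2 by (simp add: field_simps) (simp add: e_pq power2_eq_square algebra_simps)
  also have "\<dots> = ?e * (tilt f (\<lambda>y. y i) - ?M)\<^sup>2 / (1 - ?M\<^sup>2)"
  proof -
    have "(?e * (tilt f (\<lambda>y. y i) - ?M))\<^sup>2 = q\<^sup>2 * (1 - ?M\<^sup>2)\<^sup>2"
      unfolding t by (rule power_mult_distrib)
    then show ?thesis using e M beta_pos by (simp add: field_simps power2_eq_square)
  qed
  also have "\<dots> \<le> ?e * (tilt f (\<lambda>y. y i) - ?M)\<^sup>2 / \<beta>"
    using e M beta_pos by (intro divide_left_mono) auto
  finally show ?thesis .
qed

end

text \<open>Marton's induction: revealing a uniformly random spin splits the entropy into the entropy of
  a single marginal and the entropy of a system with one spin less.\<close>

lemma approximate_tensorization: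
  assumes "dobrushin S x w c \<alpha> \<beta>" and "\<And>y. y \<in> cfg S x \<Longrightarrow> 0 < f y"
  shows "entropy w S f x \<le> (\<Sum>i\<in>S. cE w S (\<lambda>y. f y * (local_bias w i f y)\<^sup>2) x) / (\<beta> * \<alpha>\<^sup>2)"
  using assms
proof (induction "card S" arbitrary: S x)
  case 0
  interpret dobrushin S x w c \<alpha> \<beta> by fact
  have "S = {}" using 0 fin by simp
  then show ?case by (simp add: entropy_def cE_def w_pos less_imp_neq)
next
  case (Suc n)
  interpret dobrushin S x w c \<alpha> \<beta> by fact
  note f_pos = Suc.prems(2)
  let ?b = "\<lambda>i. local_bias w i f"
  let ?K = "\<beta> * \<alpha>\<^sup>2"
  let ?I = "\<lambda>i. cE w S (\<lambda>y. f y * (?b i y)\<^sup>2) x"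
  let ?e = "cE w S f x"
  have K: "0 < ?K" using alpha_pos beta_pos by simp
  have e: "0 < ?e" using cE_pos[OF w_pos fin f_pos] .
  have rest: "cE w S (entropy w (S - {i}) f) x \<le> (\<Sum>j\<in>S - {i}. ?I j) / ?K" if i: "i \<in> S" for i
  proof -
    have "cE w S (entropy w (S - {i}) f) x
        \<le> cE w S (\<lambda>y. \<Sum>j\<in>S - {i}. cE w (S - {i}) (\<lambda>y. f y * (?b j y)\<^sup>2) y * (1 / ?K)) x"
    proof (rule cE_mono[OF w_pos fin])
      fix y assume y: "y \<in> cfg S x"
      have "entropy w (S - {i}) f y \<le> (\<Sum>j\<in>S - {i}. cE w (S - {i}) (\<lambda>y. f y * (?b j y)\<^sup>2) y) / ?K"
      proof (rule Suc.hyps(1))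
        show "n = card (S - {i})" using i fin Suc.hyps(2) by simp
        show "dobrushin (S - {i}) y w c \<alpha> \<beta>" by (rule dobrushin_subset[OF _ y]) auto
        show "0 < f z" if "z \<in> cfg (S - {i}) y" for z
          using cfg_subset[OF _ y, of "S - {i}"] that f_pos by auto
      qed
      then show "entropy w (S - {i}) f y
          \<le> (\<Sum>j\<in>S - {i}. cE w (S - {i}) (\<lambda>y. f y * (?b j y)\<^sup>2) y * (1 / ?K))"
        by (simp add: sum_divide_distrib)
    qed
    also have "\<dots> = (\<Sum>j\<in>S - {i}. ?I j) / ?K"
      unfolding cE_sum[OF w_pos] cE_cmult_right[OF w_pos]
      by (simp add: cE_tower[OF w_pos fin] sum_divide_distrib)
    finally show ?thesis .
  qed
  have "real (card S) * entropy w S f x = (\<Sum>i\<in>S. entropy w S f x)" by simp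
  also have "\<dots> = (\<Sum>i\<in>S. cE w S (entropy w (S - {i}) f) x + entropy w S (cE w (S - {i}) f) x)"
    by (intro sum.cong refl entropy_chain) auto
  also have "\<dots> \<le> (\<Sum>i\<in>S. (\<Sum>j\<in>S - {i}. ?I j) / ?K
      + ?e * (tilt f (\<lambda>y. y i) - cE w S (\<lambda>y. y i) x)\<^sup>2 / \<beta>)"
    using rest entropy_marginal_le[OF f_pos] by (intro sum_mono add_mono) auto
  \<comment> \<open>Each index j is missing for exactly one i, so the reduced systems account for
    card S - 1 copies of the full sum. The marginal terms supply precisely the missing copy, which
    is why the constant \<beta> \<alpha>^2 reproduces itself.\<close>
  also have "\<dots> = (\<Sum>i\<in>S. (\<Sum>j\<in>S. ?I j) / ?K - ?I i / ?K)
      + ?e * (\<Sum>i\<in>S. (tilt f (\<lambda>y. y i) - cE w S (\<lambda>y. y i) x)\<^sup>2) / \<beta>"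
    using fin by (simp add: sum.distrib sum_distrib_left sum_divide_distrib sum_diff1 diff_divide_distrib)
  also have "\<dots> \<le> (\<Sum>i\<in>S. (\<Sum>j\<in>S. ?I j) / ?K - ?I i / ?K)
      + ?e * ((\<Sum>i\<in>S. tilt f (\<lambda>y. (?b i y)\<^sup>2)) / \<alpha>\<^sup>2) / \<beta>"
    using e beta_pos tilt_marginals[OF f_pos]
    by (intro add_left_mono divide_right_mono mult_left_mono) auto
  also have "?e * ((\<Sum>i\<in>S. tilt f (\<lambda>y. (?b i y)\<^sup>2)) / \<alpha>\<^sup>2) / \<beta> = (\<Sum>i\<in>S. ?I i / ?K)"
    using e by (simp add: tilt_def[OF f_pos] sum_divide_distrib sum_distrib_left mult.commute)
  also have "(\<Sum>i\<in>S. (\<Sum>j\<in>S. ?I j) / ?K - ?I i / ?K) + (\<Sum>i\<in>S. ?I i / ?K)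
      = real (card S) * ((\<Sum>j\<in>S. ?I j) / ?K)"
    by (simp add: sum_subtractf)
  finally have "real (card S) * entropy w S f x \<le> real (card S) * ((\<Sum>j\<in>S. ?I j) / ?K)" .
  moreover have "0 < real (card S)" using Suc.hyps(2) by simp
  ultimately show ?case by (rule mult_left_le_imp_le)
qed

section \<open>Logarithmic Sobolev inequality and moments\<close>

context dobrushin
begin

text \<open>The factor 1 / (\<beta> \<alpha>^2) comes from tensorization, the factor 8 / \<beta>
  from the single-spin estimate in \<open>log_sobolev\<close>.\<close>

definition lsi_const :: real where
  "lsi_const = 8 / (\<beta>\<^sup>2 * \<alpha>\<^sup>2)"

lemma lsi_const_pos: "0 < lsi_const"
  using alpha_pos beta_pos by (simp add: lsi_const_def)

text \<open>Both values of a spin have conditional probability at least \<beta> / 4, because \<beta>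
  \<le> (1 + m) (1 - m) and each factor is at most 2.\<close>

lemma cE_single_ge:
  assumes "i \<in> S" "y \<in> cfg S x" "0 \<le> f (y(i := 1))" "0 \<le> f (y(i := -1))"
  shows "\<beta> / 4 * (f (y(i := 1)) + f (y(i := -1))) \<le> cE w {i} f y"
proof -
  let ?m = "mag w i y"
  have m: "\<bar>?m\<bar> < 1" using mag_less[OF assms(1,2)] .
  have b: "\<beta> \<le> (1 + ?m) * (1 - ?m)"
    using mag_bound[OF assms(1,2)] by (simp add: algebra_simps power2_eq_square)
  have "(1 + ?m) * (1 - ?m) \<le> (1 + ?m) * 2" "(1 + ?m) * (1 - ?m) \<le> 2 * (1 - ?m)"
    using m by (intro mult_left_mono mult_right_mono; auto)+
  then have "\<beta> / 4 \<le> (1 + ?m) / 2" "\<beta> / 4 \<le> (1 - ?m) / 2" using b by auto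
  then have "\<beta> / 4 * f (y(i := 1)) + \<beta> / 4 * f (y(i := -1)) \<le> cE w {i} f y"
    unfolding cE_single[OF w_pos] using assms by (intro add_mono mult_right_mono) auto
  then show ?thesis by (simp add: algebra_simps)
qed

text \<open>For the density F^2 the local bias times the conditional mean of F^2 equals (1 - m^2) (u
  + v) \<open>spin_diff i F\<close>, where u and v are the two values of F. As (u + v)^2 \<le> 2
  (u^2 + v^2) is bounded by 8 / \<beta> times that conditional mean, one factor of the mean
  cancels.\<close>

lemma log_sobolev:
  assumes F_pos: "\<And>y. y \<in> cfg S x \<Longrightarrow> 0 < F y"
  shows "entropy w S (\<lambda>y. (F y)\<^sup>2) x \<le> lsi_const * (\<Sum>i\<in>S. cE w S (\<lambda>y. (spin_diff i F y)\<^sup>2) x)"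
proof -
  let ?f = "\<lambda>y. (F y)\<^sup>2"
  have f_pos: "0 < ?f y" if "y \<in> cfg S x" for y using F_pos[OF that] by simp
  have loc: "cE w S (\<lambda>y. ?f y * (local_bias w i ?f y)\<^sup>2) x \<le> 8 / \<beta> * cE w S (\<lambda>y. (spin_diff i F y)\<^sup>2) x"
    if i: "i \<in> S" for i
  proof -
    let ?b = "local_bias w i ?f"
    have b: "?b (y(i := s)) = ?b y" for s y
      by (simp add: local_bias_def cE_single[OF w_pos])
    have "cE w S (\<lambda>y. ?f y * (?b y)\<^sup>2) x = cE w S (cE w {i} (\<lambda>y. (?b y)\<^sup>2 * ?f y)) x"
      using i by (simp add: cE_tower[OF w_pos fin] mult.commute)
    also have "\<dots> = cE w S (\<lambda>y. (?b y)\<^sup>2 * cE w {i} ?f y) x"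
      by (rule cE_cong[OF w_pos], rule cE_pull_out[OF w_pos]) (auto simp: cfg_single b)
    also have "\<dots> \<le> cE w S (\<lambda>y. 8 / \<beta> * (spin_diff i F y)\<^sup>2) x"
    proof (rule cE_mono[OF w_pos fin])
      fix y assume y: "y \<in> cfg S x"
      let ?u = "F (y(i := 1))" and ?v = "F (y(i := -1))" and ?e = "cE w {i} ?f y" and ?m = "mag w i y"
      have uv: "0 < ?u" "0 < ?v" using cfg_upd[OF y i] by (auto intro: F_pos)
      have e: "\<beta> / 4 * (?u\<^sup>2 + ?v\<^sup>2) \<le> ?e"
        using cE_single_ge[OF i y, of ?f] by simp
      moreover have "0 < \<beta> / 4 * (?u\<^sup>2 + ?v\<^sup>2)"
        using beta_pos uv by (intro mult_pos_pos add_pos_pos) auto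
      ultimately have e_pos: "0 < ?e" by linarith
      have m: "0 \<le> 1 - ?m\<^sup>2" "1 - ?m\<^sup>2 \<le> 1" using mag_bound[OF i y] beta_pos by auto
      have "?b y * ?e = cE w {i} (\<lambda>z. ?f z * z i) y - ?m * ?e"
        using e_pos by (simp add: local_bias_def field_simps)
      also have "\<dots> = (1 - ?m\<^sup>2) * ((?u + ?v) * spin_diff i F y)"
        by (simp add: cE_single[OF w_pos] spin_diff_def field_simps power2_eq_square)
      finally have "(?b y * ?e)\<^sup>2 = (1 - ?m\<^sup>2)\<^sup>2 * ((?u + ?v)\<^sup>2 * (spin_diff i F y)\<^sup>2)"
        by (simp add: power_mult_distrib)
      also have "\<dots> \<le> 1 * ((?u + ?v)\<^sup>2 * (spin_diff i F y)\<^sup>2)"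
        using m by (intro mult_right_mono power_le_one) auto
      also have "\<dots> \<le> (8 / \<beta> * ?e) * (spin_diff i F y)\<^sup>2"
      proof -
        have "(?u + ?v)\<^sup>2 \<le> 2 * (?u\<^sup>2 + ?v\<^sup>2)"
          using zero_le_power2[of "?u - ?v"] by (simp add: power2_eq_square algebra_simps)
        also have "\<dots> \<le> 8 / \<beta> * ?e" using e beta_pos by (simp add: field_simps)
        finally show ?thesis using mult_right_mono[of "(?u + ?v)\<^sup>2" "8 / \<beta> * ?e" "(spin_diff i F y)\<^sup>2"] by simp
      qed
      finally have "(?b y)\<^sup>2 * ?e * ?e \<le> 8 / \<beta> * (spin_diff i F y)\<^sup>2 * ?e"
        by (simp add: power_mult_distrib power2_eq_square mult_ac)
      then show "(?b y)\<^sup>2 * ?e \<le> 8 / \<beta> * (spin_diff i F y)\<^sup>2"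
        using e_pos by (rule mult_right_le_imp_le)
    qed
    finally show ?thesis unfolding cE_cmult[OF w_pos] .
  qed
  have "entropy w S ?f x \<le> (\<Sum>i\<in>S. cE w S (\<lambda>y. ?f y * (local_bias w i ?f y)\<^sup>2) x) / (\<beta> * \<alpha>\<^sup>2)"
    using approximate_tensorization[OF dobrushin_axioms f_pos] .
  also have "\<dots> \<le> (\<Sum>i\<in>S. 8 / \<beta> * cE w S (\<lambda>y. (spin_diff i F y)\<^sup>2) x) / (\<beta> * \<alpha>\<^sup>2)"
    using loc alpha_pos beta_pos by (intro divide_right_mono sum_mono) auto
  also have "\<dots> = lsi_const * (\<Sum>i\<in>S. cE w S (\<lambda>y. (spin_diff i F y)\<^sup>2) x)"
    unfolding sum_distrib_left[symmetric] by (simp add: lsi_const_def power2_eq_square mult.assoc)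
  finally show ?thesis .
qed

text \<open>Jensen's inequality for ln (1 / F) under the measure with density proportional to F^2
  bounds the entropy of F^2 from below by a ratio of moments. With F = g^m this relates the moments
  of g of orders 2m and m directly.\<close>

lemma log_moment_ratio_le:
  assumes F_pos: "\<And>y. y \<in> cfg S x \<Longrightarrow> 0 < F y"
  shows "cE w S (\<lambda>y. (F y)\<^sup>2) x * ln (cE w S (\<lambda>y. (F y)\<^sup>2) x / (cE w S F x)\<^sup>2)
    \<le> lsi_const * (\<Sum>i\<in>S. cE w S (\<lambda>y. (spin_diff i F y)\<^sup>2) x)"
proof -
  let ?s = "cE w S (\<lambda>y. (F y)\<^sup>2) x" and ?e = "cE w S F x"
  have e: "0 < ?e" using cE_pos[OF w_pos fin F_pos] .
  have s: "0 < ?s" by (rule cE_pos[OF w_pos fin]) (simp add: less_imp_neq[OF F_pos, symmetric])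
  have "0 = cE w S (\<lambda>y. (F y)\<^sup>2 - ?s / ?e * F y) x"
    unfolding cE_diff[OF w_pos] cE_cmult[OF w_pos] using e by simp
  also have "\<dots> \<le> cE w S (\<lambda>y. (F y)\<^sup>2 * ln (F y) - (F y)\<^sup>2 * ln (?s / ?e)) x"
  proof (rule cE_mono[OF w_pos fin])
    fix y assume "y \<in> cfg S x"
    then have F: "0 < F y" by (rule F_pos)
    have "ln (?s / ?e / F y) \<le> ?s / ?e / F y - 1"
      using F s e by (intro ln_le_minus_one) simp
    then have "(F y)\<^sup>2 * ln (?s / ?e / F y) \<le> (F y)\<^sup>2 * (?s / ?e / F y - 1)"
      by (intro mult_left_mono) auto
    moreover have "(F y)\<^sup>2 * ln (?s / ?e / F y) = (F y)\<^sup>2 * ln (?s / ?e) - (F y)\<^sup>2 * ln (F y)"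
      using F s e by (subst ln_div) (auto simp: right_diff_distrib)
    moreover have "(F y)\<^sup>2 * (?s / ?e / F y - 1) = ?s / ?e * F y - (F y)\<^sup>2"
      using F e by (simp add: field_simps power2_eq_square)
    ultimately show "(F y)\<^sup>2 - ?s / ?e * F y \<le> (F y)\<^sup>2 * ln (F y) - (F y)\<^sup>2 * ln (?s / ?e)"
      by linarith
  qed
  also have "\<dots> = cE w S (\<lambda>y. (F y)\<^sup>2 * ln (F y)) x - ?s * ln (?s / ?e)"
    unfolding cE_diff[OF w_pos] cE_cmult_right[OF w_pos] ..
  finally have 1: "?s * ln (?s / ?e) \<le> cE w S (\<lambda>y. (F y)\<^sup>2 * ln (F y)) x" by simp
  have "cE w S (\<lambda>y. (F y)\<^sup>2 * ln ((F y)\<^sup>2)) x = cE w S (\<lambda>y. 2 * ((F y)\<^sup>2 * ln (F y))) x"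
    using F_pos by (intro cE_cong[OF w_pos]) (simp add: ln_realpow)
  then have "entropy w S (\<lambda>y. (F y)\<^sup>2) x = 2 * cE w S (\<lambda>y. (F y)\<^sup>2 * ln (F y)) x - ?s * ln ?s"
    unfolding entropy_def cE_cmult[OF w_pos] by simp
  moreover have "?s * ln (?s / ?e\<^sup>2) = 2 * (?s * ln (?s / ?e)) - ?s * ln ?s"
    using s e by (simp add: ln_div ln_realpow algebra_simps)
  ultimately have "?s * ln (?s / ?e\<^sup>2) \<le> entropy w S (\<lambda>y. (F y)\<^sup>2) x"
    using 1 by linarith
  then show ?thesis using log_sobolev[of F, OF F_pos] by linarith
qed

text \<open>Adding a constant makes g positive without changing its differences. The linearization V
  \<le> (M^2 + V) ln ((M^2 + V) / M^2), a case of ln u \<le> u - 1, holds for every M > 0, so no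
  limit in M is required.\<close>

lemma poincare:
  "cE w S (\<lambda>y. (g y)\<^sup>2) x - (cE w S g x)\<^sup>2 \<le> lsi_const * (\<Sum>i\<in>S. cE w S (\<lambda>y. (spin_diff i g y)\<^sup>2) x)"
proof -
  let ?e = "cE w S g x"
  define V where "V = cE w S (\<lambda>y. (g y)\<^sup>2) x - ?e\<^sup>2"
  define M where "M = 1 + \<bar>?e\<bar> + (\<Sum>y\<in>cfg S x. \<bar>g y\<bar>)"
  define F where "F y = M + (g y - ?e)" for y
  have M: "0 < M" unfolding M_def by (intro add_pos_nonneg sum_nonneg) auto
  have F_pos: "0 < F y" if "y \<in> cfg S x" for y
  proof -
    have "\<bar>g y\<bar> \<le> (\<Sum>y\<in>cfg S x. \<bar>g y\<bar>)"
      using fin that by (intro member_le_sum) auto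
    then show ?thesis by (simp add: F_def M_def)
  qed
  have eF: "cE w S F x = M"
    unfolding F_def by (simp add: cE_add[OF w_pos] cE_diff[OF w_pos] cE_const[OF w_pos fin])
  have "(\<lambda>y. (F y)\<^sup>2) = (\<lambda>y. (M - ?e)\<^sup>2 + ((g y)\<^sup>2 + 2 * (M - ?e) * g y))"
    by (auto simp: F_def power2_eq_square algebra_simps)
  then have sF: "cE w S (\<lambda>y. (F y)\<^sup>2) x = M\<^sup>2 + V"
    by (simp add: cE_add[OF w_pos] cE_cmult[OF w_pos] cE_const[OF w_pos fin] V_def)
       (simp add: power2_eq_square algebra_simps)
  have V: "0 \<le> V" unfolding V_def using cE_square_le[OF w_pos fin] by simp
  have MV: "0 < M\<^sup>2 + V" using M V by (intro add_pos_nonneg) auto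
  have "ln (M\<^sup>2 / (M\<^sup>2 + V)) \<le> M\<^sup>2 / (M\<^sup>2 + V) - 1"
    using M MV by (intro ln_le_minus_one) auto
  moreover have "M\<^sup>2 / (M\<^sup>2 + V) - 1 = - (V / (M\<^sup>2 + V))" using MV by (simp add: field_simps)
  moreover have "ln (M\<^sup>2 / (M\<^sup>2 + V)) = - ln ((M\<^sup>2 + V) / M\<^sup>2)"
    using M MV by (simp add: ln_div)
  ultimately have "V / (M\<^sup>2 + V) \<le> ln ((M\<^sup>2 + V) / M\<^sup>2)" by linarith
  then have "V \<le> (M\<^sup>2 + V) * ln ((M\<^sup>2 + V) / M\<^sup>2)"
    using MV by (simp add: pos_divide_le_eq mult.commute)
  also have "\<dots> \<le> lsi_const * (\<Sum>i\<in>S. cE w S (\<lambda>y. (spin_diff i F y)\<^sup>2) x)"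
    using log_moment_ratio_le[of F, OF F_pos] unfolding sF eF .
  finally have "V \<le> lsi_const * (\<Sum>i\<in>S. cE w S (\<lambda>y. (spin_diff i F y)\<^sup>2) x)" .
  moreover have "spin_diff i F = spin_diff i g" for i
    by (auto simp: spin_diff_def F_def)
  ultimately show ?thesis by (simp add: V_def)
qed

text \<open>The difference u^m - v^m is u - v times m products, each at most max u v ^ (m - 1). The
  maximum may be attained at the flipped configuration; replacing it by a conditional mean over spin
  i costs the factor 4 / \<beta>.\<close>

lemma cE_power_diff_le:
  assumes g: "\<And>y. y \<in> cfg S x \<Longrightarrow> 0 \<le> g y" and i: "i \<in> S" and m: "0 < m"
  shows "cE w S (\<lambda>y. (spin_diff i (\<lambda>z. g z ^ m) y)\<^sup>2) x
    \<le> 4 / \<beta> * (real m)\<^sup>2 * cE w S (\<lambda>y. g y ^ (2 * (m - 1)) * (spin_diff i g y)\<^sup>2) x"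
proof -
  let ?h = "\<lambda>y. g y ^ (2 * (m - 1))" and ?d = "\<lambda>y. (spin_diff i g y)\<^sup>2"
  have "cE w S (\<lambda>y. (spin_diff i (\<lambda>z. g z ^ m) y)\<^sup>2) x
      \<le> cE w S (\<lambda>y. (4 / \<beta> * (real m)\<^sup>2) * cE w {i} (\<lambda>y. ?h y * ?d y) y) x"
  proof (rule cE_mono[OF w_pos fin])
    fix y assume y: "y \<in> cfg S x"
    let ?u = "g (y(i := 1))" and ?v = "g (y(i := -1))"
    have uv: "0 \<le> ?u" "0 \<le> ?v" using cfg_upd[OF y i] by (auto intro: g)
    let ?s = "\<Sum>k<m. ?v ^ (m - Suc k) * ?u ^ k"
    have s0: "0 \<le> ?s" using uv by (intro sum_nonneg) auto
    have "?s \<le> (\<Sum>k<m. (max ?u ?v) ^ (m - 1))"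
    proof (rule sum_mono)
      fix k assume "k \<in> {..<m}"
      then have k: "m - 1 = (m - Suc k) + k" by auto
      show "?v ^ (m - Suc k) * ?u ^ k \<le> (max ?u ?v) ^ (m - 1)"
        unfolding k power_add using uv by (intro mult_mono power_mono) auto
    qed
    then have "?s\<^sup>2 \<le> (real m * (max ?u ?v) ^ (m - 1))\<^sup>2"
      using s0 by (intro power_mono) auto
    also have "\<dots> = (real m)\<^sup>2 * (max ?u ?v) ^ (2 * (m - 1))"
      by (simp add: power_mult_distrib power_mult[symmetric] mult.commute)
    also have "(max ?u ?v) ^ (2 * (m - 1)) \<le> ?u ^ (2 * (m - 1)) + ?v ^ (2 * (m - 1))"
      using uv by (auto simp: max_def)
    finally have s: "?s\<^sup>2 \<le> (real m)\<^sup>2 * (?h (y(i := 1)) + ?h (y(i := -1)))"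
      by (simp add: mult_left_mono)
    have "?u ^ m - ?v ^ m = (?u - ?v) * ?s"
      by (rule power_diff_sumr2)
    then have "(spin_diff i (\<lambda>z. g z ^ m) y)\<^sup>2 = ?s\<^sup>2 * ?d y"
      by (simp add: spin_diff_def power_mult_distrib power_divide)
    also have "\<dots> \<le> (real m)\<^sup>2 * (?h (y(i := 1)) + ?h (y(i := -1))) * ?d y"
      using s by (intro mult_right_mono) auto
    also have "\<dots> \<le> (real m)\<^sup>2 * (4 / \<beta> * cE w {i} ?h y) * ?d y"
      using cE_single_ge[OF i y, of ?h] uv beta_pos
      by (intro mult_right_mono mult_left_mono) (auto simp: field_simps)
    also have "\<dots> = (4 / \<beta> * (real m)\<^sup>2) * (?d y * cE w {i} ?h y)" by simp
    also have "?d y * cE w {i} ?h y = cE w {i} (\<lambda>y. ?d y * ?h y) y"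
      by (rule cE_pull_out[OF w_pos, symmetric]) (auto simp: cfg_single)
    finally show "(spin_diff i (\<lambda>z. g z ^ m) y)\<^sup>2 \<le> (4 / \<beta> * (real m)\<^sup>2) * cE w {i} (\<lambda>y. ?h y * ?d y) y"
      by (simp add: mult.commute)
  qed
  also have "\<dots> = 4 / \<beta> * (real m)\<^sup>2 * cE w S (\<lambda>y. ?h y * ?d y) x"
    unfolding cE_cmult[OF w_pos] using i by (simp add: cE_tower[OF w_pos fin])
  finally show ?thesis .
qed

section \<open>Growth of moments along powers of two\<close>

definition moment_const :: real where
  "moment_const = 4 / \<beta> * lsi_const + lsi_const"

lemma moment_const_pos: "0 < moment_const" and lsi_const_le: "lsi_const \<le> moment_const"
  and lsi_moment_const_le: "4 / \<beta> * lsi_const \<le> moment_const"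
  using lsi_const_pos beta_pos by (auto simp: moment_const_def intro: add_pos_pos)

text \<open>The arithmetic-geometric mean inequality for m - 1 copies of a^m and one of b^m,
  obtained from Bernoulli's inequality for (b / a)^m.\<close>

lemma young_power:
  fixes a b :: real
  assumes "0 \<le> a" "0 \<le> b" "0 < m"
  shows "real m * (a ^ (m - 1) * b) \<le> real (m - 1) * a ^ m + b ^ m"
proof (cases "a = 0")
  case True
  then show ?thesis using assms by (cases "m = 1") (auto simp: power_0_left)
next
  case False
  then have a: "0 < a" using assms by simp
  have m: "a ^ m = a ^ (m - 1) * a" using assms(3) by (simp add: power_eq_if)
  have "1 + real m * (b / a - 1) \<le> (1 + (b / a - 1)) ^ m"
    using assms a by (intro Bernoulli_inequality) auto
  then have "a ^ m * (1 + real m * (b / a - 1)) \<le> a ^ m * (b / a) ^ m"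
    using a by (intro mult_left_mono) auto
  also have "\<dots> = b ^ m" using a by (simp add: power_divide)
  also have "a ^ m * (1 + real m * (b / a - 1)) = a ^ m - real m * a ^ m + real m * (a ^ (m - 1) * b)"
    using a by (simp add: m field_simps)
  finally show ?thesis using assms(3) by (simp add: of_nat_diff algebra_simps)
qed

text \<open>If the bound failed at order 2m, Young's inequality would absorb the gradient term into
  the moment P itself. The inequality for g^m would then yield P \<le> exp (m / 2) Q^2 \<le> 2^m
  Q^2, with Q the moment of order m; the induction hypothesis for Q turns this into the bound that
  was assumed to fail.\<close>

lemma dyadic_moments:
  assumes g: "\<And>y. y \<in> cfg S x \<Longrightarrow> 0 < g y"
    and H: "\<And>y. y \<in> cfg S x \<Longrightarrow> (\<Sum>i\<in>S. (spin_diff i g y)\<^sup>2) \<le> H y"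
    and base: "cE w S (\<lambda>y. (g y)\<^sup>2) x \<le> 2 * moment_const * cE w S H x"
  shows "cE w S (\<lambda>y. (g y) ^ (2 * 2 ^ k)) x
    \<le> (2 * moment_const * 2 ^ k) ^ (2 ^ k) * cE w S (\<lambda>y. H y ^ (2 ^ k)) x"
proof (induction k)
  case 0
  then show ?case using base by simp
next
  case (Suc k)
  let ?C = moment_const
  define l where "l = (2::nat) ^ k"
  define m where "m = 2 * l"
  have l: "0 < l" by (simp add: l_def)
  have m: "0 < m" "m = 2 ^ Suc k" "real m = 2 * real l" using l by (auto simp: m_def l_def)
  \<comment> \<open>The 2 serves twice: it makes \<open>?C * real m / \<Lambda>\<close> equal to
    1/2, and \<Lambda> / 2 is the constant of the preceding order, so that the doubling pays for the
    factor 2^m.\<close>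
  define \<Lambda> where "\<Lambda> = 2 * ?C * real m"
  have \<Lambda>: "0 < \<Lambda>" unfolding \<Lambda>_def using moment_const_pos m(1) by simp
  have H0: "0 \<le> H y" if "y \<in> cfg S x" for y
    by (rule order_trans[OF _ H[OF that]]) (auto intro: sum_nonneg)
  define P where "P = cE w S (\<lambda>y. g y ^ (2 * m)) x"
  define Q where "Q = cE w S (\<lambda>y. g y ^ m) x"
  define R where "R = cE w S (\<lambda>y. H y ^ m) x"
  have pos: "0 < P" "0 < Q" "0 \<le> R"
    unfolding P_def Q_def R_def using g H0 by (auto intro!: cE_pos[OF w_pos fin] cE_nonneg[OF w_pos fin])
  have gm: "(\<lambda>y. (g y ^ m)\<^sup>2) = (\<lambda>y. g y ^ (2 * m))" by (simp add: power_mult[symmetric] mult.commute)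
  have "P \<le> \<Lambda> ^ m * R"
  proof (rule ccontr)
    assume "\<not> P \<le> \<Lambda> ^ m * R"
    then have contra: "\<Lambda> ^ m * R < P" by simp
    have "P * ln (P / Q\<^sup>2) \<le> lsi_const * (\<Sum>i\<in>S. cE w S (\<lambda>y. (spin_diff i (\<lambda>y. g y ^ m) y)\<^sup>2) x)"
      using log_moment_ratio_le[of "\<lambda>y. g y ^ m"] g unfolding gm P_def Q_def by simp
    also have "\<dots> \<le> lsi_const * (\<Sum>i\<in>S. 4 / \<beta> * (real m)\<^sup>2
        * cE w S (\<lambda>y. g y ^ (2 * (m - 1)) * (spin_diff i g y)\<^sup>2) x)"
      using lsi_const_pos g m by (intro mult_left_mono sum_mono cE_power_diff_le) (auto intro: less_imp_le)
    also have "\<dots> = 4 / \<beta> * lsi_const * (real m)\<^sup>2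
        * cE w S (\<lambda>y. g y ^ (2 * (m - 1)) * (\<Sum>i\<in>S. (spin_diff i g y)\<^sup>2)) x"
      unfolding sum_distrib_left[of "g _ ^ _"] cE_sum[OF w_pos] by (simp add: sum_distrib_left mult_ac)
    also have "\<dots> \<le> ?C * (real m)\<^sup>2 * cE w S (\<lambda>y. g y ^ (2 * (m - 1)) * H y) x"
      using lsi_moment_const_le H m g moment_const_pos lsi_const_pos beta_pos
      by (intro mult_mono cE_mono[OF w_pos fin] cE_nonneg[OF w_pos fin] mult_left_mono)
         (auto intro!: mult_nonneg_nonneg sum_nonneg)
    also have "\<dots> = ?C * real m / \<Lambda> * cE w S (\<lambda>y. real m * (g y ^ (2 * (m - 1)) * (\<Lambda> * H y))) x"
      using \<Lambda> by (simp add: mult.left_commute[of _ \<Lambda>] cE_cmult[OF w_pos] power2_eq_square)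
    \<comment> \<open>Young's inequality with a = g^2 and b = \<Lambda> H. The weight \<Lambda> is
      inserted to make the remainder \<Lambda>^m R, which lies below P by the contrary
      assumption.\<close>
    also have "\<dots> \<le> ?C * real m / \<Lambda> * (real (m - 1) * P + \<Lambda> ^ m * R)"
    proof (intro mult_left_mono)
      have "cE w S (\<lambda>y. real m * (g y ^ (2 * (m - 1)) * (\<Lambda> * H y))) x
          \<le> cE w S (\<lambda>y. real (m - 1) * g y ^ (2 * m) + \<Lambda> ^ m * H y ^ m) x"
      proof (rule cE_mono[OF w_pos fin])
        fix y assume y: "y \<in> cfg S x"
        show "real m * (g y ^ (2 * (m - 1)) * (\<Lambda> * H y)) \<le> real (m - 1) * g y ^ (2 * m) + \<Lambda> ^ m * H y ^ m"
          using young_power[of "(g y)\<^sup>2" "\<Lambda> * H y" m] \<Lambda> H0[OF y] m(1)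
          by (simp add: power_mult power_mult_distrib)
      qed
      then show "cE w S (\<lambda>y. real m * (g y ^ (2 * (m - 1)) * (\<Lambda> * H y))) x \<le> real (m - 1) * P + \<Lambda> ^ m * R"
        by (simp add: cE_add[OF w_pos] cE_cmult[OF w_pos] P_def R_def)
    qed (use moment_const_pos \<Lambda> in auto)
    also have "\<dots> \<le> ?C * real m / \<Lambda> * (real (m - 1) * P + P)"
      using contra moment_const_pos \<Lambda> by (intro mult_left_mono) auto
    also have "\<dots> = P * (real m / 2)"
      using m moment_const_pos by (simp add: \<Lambda>_def of_nat_diff field_simps)
    finally have "ln (P / Q\<^sup>2) \<le> real m / 2" using pos by (simp add: mult_le_cancel_left)
    then have "exp (ln (P / Q\<^sup>2)) \<le> exp (real m / 2)" by (simp only: exp_le_cancel_iff)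
    then have "P / Q\<^sup>2 \<le> exp (real m / 2)" using pos by simp
    also have "\<dots> = exp (1 / 2) ^ m" by (simp add: exp_of_nat_mult[symmetric])
    also have "\<dots> \<le> 2 ^ m"
    proof (rule power_mono)
      show "exp (1 / 2 :: real) \<le> 2" using exp_bound_half[of "1/2::real"] by simp
    qed simp
    finally have PQ: "P \<le> 2 ^ m * Q\<^sup>2" using pos by (simp add: pos_divide_le_eq)
    have half: "\<Lambda> / 2 = 2 * ?C * 2 ^ k" by (simp add: \<Lambda>_def m(3) l_def)
    have "Q \<le> (\<Lambda> / 2) ^ l * cE w S (\<lambda>y. H y ^ l) x"
      using Suc.IH unfolding half Q_def m_def l_def .
    then have "Q\<^sup>2 \<le> ((\<Lambda> / 2) ^ l * cE w S (\<lambda>y. H y ^ l) x)\<^sup>2"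
      using pos by (intro power_mono) auto
    also have "\<dots> = (\<Lambda> / 2) ^ m * (cE w S (\<lambda>y. H y ^ l) x)\<^sup>2"
      by (simp add: power_mult_distrib m_def power_mult[symmetric] mult.commute)
    also have "\<dots> \<le> (\<Lambda> / 2) ^ m * R"
      using cE_square_le[of w S "\<lambda>y. H y ^ l" x, OF w_pos fin] \<Lambda>
      by (intro mult_left_mono) (auto simp: R_def m_def power_mult[symmetric] mult.commute)
    finally have "P \<le> 2 ^ m * ((\<Lambda> / 2) ^ m * R)"
      using PQ by (meson mult_left_mono order_trans zero_le_numeral zero_le_power)
    also have "\<dots> = \<Lambda> ^ m * R" by (simp add: power_divide)
    finally show False using contra by simp
  qed
  then show ?case unfolding P_def R_def \<Lambda>_def m(2) by simp
qed

end

text \<open>The reverse triangle inequality for u and v, each extended by the same coordinate sqrt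
  \<epsilon>.\<close>

lemma sqrt_sum_squares_lipschitz:
  fixes u v :: "'a \<Rightarrow> real"
  assumes "0 \<le> \<epsilon>"
  shows "(sqrt ((\<Sum>a\<in>I. (u a)\<^sup>2) + \<epsilon>) - sqrt ((\<Sum>a\<in>I. (v a)\<^sup>2) + \<epsilon>))\<^sup>2 \<le> (\<Sum>a\<in>I. (u a - v a)\<^sup>2)"
proof -
  let ?a = "\<Sum>a\<in>I. (u a)\<^sup>2" and ?b = "\<Sum>a\<in>I. (v a)\<^sup>2" and ?c = "\<Sum>a\<in>I. u a * v a"
  have ab: "0 \<le> ?a" "0 \<le> ?b" by (auto intro: sum_nonneg)
  have d: "(\<Sum>a\<in>I. (u a - v a)\<^sup>2) = ?a + ?b - 2 * ?c"
    by (simp add: power2_diff sum.distrib sum_subtractf sum_distrib_left mult.assoc)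
  have "0 \<le> (\<Sum>a\<in>I. (u a - v a)\<^sup>2)" by (rule sum_nonneg) simp
  then have c: "2 * ?c \<le> ?a + ?b" using d by simp
  have "(?c + \<epsilon>)\<^sup>2 = ?c\<^sup>2 + \<epsilon> * (2 * ?c) + \<epsilon>\<^sup>2"
    by (simp add: power2_eq_square algebra_simps)
  also have "\<dots> \<le> ?a * ?b + \<epsilon> * (?a + ?b) + \<epsilon>\<^sup>2"
    using Cauchy_Schwarz_ineq_sum[of u v I] c assms
    by (intro add_mono mult_left_mono order_refl)
  also have "\<dots> = (?a + \<epsilon>) * (?b + \<epsilon>)"
    by (simp add: power2_eq_square algebra_simps)
  finally have "?c + \<epsilon> \<le> sqrt (?a + \<epsilon>) * sqrt (?b + \<epsilon>)"
    by (simp add: real_sqrt_mult[symmetric] real_le_rsqrt)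
  then show ?thesis
    using ab assms unfolding d by (simp add: power2_diff)
qed

context dobrushin
begin

lemma cE_eq_0D:
  assumes "cE w S f x = 0" "\<And>y. y \<in> cfg S x \<Longrightarrow> 0 \<le> f y" "y \<in> cfg S x"
  shows "f y = 0"
proof -
  have "(\<Sum>y\<in>cfg S x. w y * f y) = 0"
    using assms(1) part_pos[of w S x, OF w_pos fin] by (simp add: cE_def)
  moreover have "0 \<le> w z * f z" if "z \<in> cfg S x" for z
    using assms(2)[OF that] w_pos[of z] by simp
  ultimately have "w y * f y = 0"
    using assms(3) fin by (subst (asm) sum_nonneg_eq_0_iff) auto
  then show ?thesis using w_pos[of y] by simp
qed

text \<open>Centering enters only at second order, where the Poincare inequality is summed over the
  components. For higher orders the scalar bound is applied to the Euclidean norm, whose gradient is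
  dominated by the gradients of the components.\<close>

lemma vector_moments:
  fixes \<phi> :: "'a \<Rightarrow> ('i \<Rightarrow> real) \<Rightarrow> real"
  assumes centered: "\<And>a. a \<in> I \<Longrightarrow> cE w S (\<phi> a) x = 0"
  shows "cE w S (\<lambda>y. (\<Sum>a\<in>I. (\<phi> a y)\<^sup>2) ^ (2 ^ k)) x
    \<le> (2 * moment_const * 2 ^ k) ^ (2 ^ k)
      * cE w S (\<lambda>y. (\<Sum>a\<in>I. \<Sum>i\<in>S. (spin_diff i (\<phi> a) y)\<^sup>2) ^ (2 ^ k)) x"
proof -
  define U where "U y = (\<Sum>a\<in>I. (\<phi> a y)\<^sup>2)" for y
  define H where "H y = (\<Sum>a\<in>I. \<Sum>i\<in>S. (spin_diff i (\<phi> a) y)\<^sup>2)" for y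
  let ?C = moment_const
  let ?E = "\<lambda>f. cE w S f x"
  have U0: "0 \<le> U y" and H0: "0 \<le> H y" for y
    by (auto simp: U_def H_def intro!: sum_nonneg)
  have EH0: "0 \<le> ?E H" using H0 by (intro cE_nonneg[OF w_pos fin])
  have "?E U = (\<Sum>a\<in>I. ?E (\<lambda>y. (\<phi> a y)\<^sup>2))"
    unfolding U_def by (rule cE_sum[OF w_pos])
  also have "\<dots> \<le> (\<Sum>a\<in>I. lsi_const * (\<Sum>i\<in>S. ?E (\<lambda>y. (spin_diff i (\<phi> a) y)\<^sup>2)))"
  proof (rule sum_mono)
    fix a assume "a \<in> I"
    then show "?E (\<lambda>y. (\<phi> a y)\<^sup>2) \<le> lsi_const * (\<Sum>i\<in>S. ?E (\<lambda>y. (spin_diff i (\<phi> a) y)\<^sup>2))"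
      using poincare[of "\<phi> a"] centered[of a] by simp
  qed
  also have "\<dots> = lsi_const * ?E H"
    unfolding H_def by (simp add: cE_sum[OF w_pos] sum_distrib_left)
  also have "\<dots> \<le> ?C * ?E H"
    using lsi_const_le EH0 by (rule mult_right_mono)
  finally have EU: "?E U \<le> ?C * ?E H" .
  have "?E (\<lambda>y. U y ^ (2 ^ k)) \<le> (2 * ?C * 2 ^ k) ^ (2 ^ k) * ?E (\<lambda>y. H y ^ (2 ^ k))"
  proof (cases "?E H = 0")
    case True
    then have "?E U = 0" using EU cE_nonneg[of w S x U, OF w_pos fin] U0 by simp
    then have "U y = 0" if "y \<in> cfg S x" for y using cE_eq_0D[of U y] U0 that by blast
    then have "?E (\<lambda>y. U y ^ (2 ^ k)) = ?E (\<lambda>y. 0)" by (intro cE_cong[OF w_pos]) simp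
    also have "\<dots> = 0" by (rule cE_const[OF w_pos fin])
    also have "\<dots> \<le> (2 * ?C * 2 ^ k) ^ (2 ^ k) * ?E (\<lambda>y. H y ^ (2 ^ k))"
      using moment_const_pos H0 by (intro mult_nonneg_nonneg cE_nonneg[OF w_pos fin]) auto
    finally show ?thesis .
  next
    case False
    \<comment> \<open>The regularization keeps the norm strictly positive. Its size equals the bound
      just found for E U, so the second moment at most doubles; this is the 2 in front of
      \<open>moment_const\<close>.\<close>
    define \<epsilon> where "\<epsilon> = ?C * ?E H"
    have \<epsilon>: "0 < \<epsilon>" using False EH0 moment_const_pos by (simp add: \<epsilon>_def)
    define g where "g y = sqrt (U y + \<epsilon>)" for y
    have g_pos: "0 < g y" for y using U0[of y] \<epsilon> by (simp add: g_def)
    have g2: "(g y)\<^sup>2 = U y + \<epsilon>" for y using U0[of y] \<epsilon> by (simp add: g_def)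
    have "?E (\<lambda>y. U y ^ (2 ^ k)) \<le> ?E (\<lambda>y. g y ^ (2 * 2 ^ k))"
      unfolding power_mult g2 using U0 \<epsilon> by (intro cE_mono[OF w_pos fin] power_mono) auto
    also have "\<dots> \<le> (2 * ?C * 2 ^ k) ^ (2 ^ k) * ?E (\<lambda>y. H y ^ (2 ^ k))"
    proof (rule dyadic_moments)
      show "0 < g y" for y by (rule g_pos)
      show "?E (\<lambda>y. (g y)\<^sup>2) \<le> 2 * ?C * ?E H"
        unfolding g2 using EU by (simp add: cE_add[OF w_pos] cE_const[OF w_pos fin] \<epsilon>_def)
      fix y
      have "(spin_diff i g y)\<^sup>2 \<le> (\<Sum>a\<in>I. (spin_diff i (\<phi> a) y)\<^sup>2)" for i
        using sqrt_sum_squares_lipschitz[of \<epsilon> "\<lambda>a. \<phi> a (y(i := 1))" I "\<lambda>a. \<phi> a (y(i := -1))"] \<epsilon>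
        by (simp add: spin_diff_def g_def U_def power_divide sum_divide_distrib[symmetric])
      then have "(\<Sum>i\<in>S. (spin_diff i g y)\<^sup>2) \<le> (\<Sum>i\<in>S. \<Sum>a\<in>I. (spin_diff i (\<phi> a) y)\<^sup>2)"
        by (rule sum_mono)
      also have "\<dots> = H y" unfolding H_def by (rule sum.swap)
      finally show "(\<Sum>i\<in>S. (spin_diff i g y)\<^sup>2) \<le> H y" .
    qed
    finally show ?thesis .
  qed
  then show ?thesis unfolding U_def H_def .
qed

end

section \<open>The Ising model\<close>

lemma cube_eq_cfg: "cube n = cfg {..<n} (\<lambda>_. undefined)"
  by (auto simp: cube_def cfg_def PiE_def Pi_def extensional_def)

lemma gibbs_weight_pos: "0 < gibbs_weight n J h y"
  by (simp add: gibbs_weight_def)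

lemma qE_eq_cE: "qE n J h F = cE (gibbs_weight n J h) {..<n} F (\<lambda>_. undefined)"
  by (simp add: qE_def cE_def partition_fn_def cube_eq_cfg)

text \<open>Every pair containing i occurs in both orders and the spin jumps by 2, which gives the
  4; the zero diagonal excludes the pair (i, i).\<close>

lemma quadratic_form_diff:
  fixes J :: "nat \<Rightarrow> nat \<Rightarrow> real"
  assumes i: "i < n" and sym: "\<And>a b. a < n \<Longrightarrow> b < n \<Longrightarrow> J a b = J b a" and diag: "J i i = 0"
  shows "(\<Sum>a<n. \<Sum>b<n. J a b * (y(i := 1)) a * (y(i := 1)) b)
    - (\<Sum>a<n. \<Sum>b<n. J a b * (y(i := -1)) a * (y(i := -1)) b) = 4 * (\<Sum>b<n. J i b * y b)"
proof -
  have "(\<Sum>a<n. \<Sum>b<n. J a b * (y(i := 1)) a * (y(i := 1)) b)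
    - (\<Sum>a<n. \<Sum>b<n. J a b * (y(i := -1)) a * (y(i := -1)) b)
    = (\<Sum>a<n. \<Sum>b<n. J a b * (y(i := 1)) a * (y(i := 1)) b - J a b * (y(i := -1)) a * (y(i := -1)) b)"
    by (simp only: sum_subtractf)
  also have "\<dots> = (\<Sum>a<n. \<Sum>b<n. (if a = i then 2 * (J i b * y b) else 0) + (if b = i then 2 * (J a i * y a) else 0))"
    using diag by (intro sum.cong refl) auto
  also have "\<dots> = (\<Sum>b<n. 2 * (J i b * y b)) + (\<Sum>a<n. 2 * (J a i * y a))"
  proof -
    have "(\<Sum>a<n. \<Sum>b<n. (if a = i then 2 * (J i b * y b) else 0)) = (\<Sum>a<n. if a = i then (\<Sum>b<n. 2 * (J i b * y b)) else 0)"
      by (intro sum.cong refl) auto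
    then show ?thesis using i by (simp add: sum.distrib sum.delta)
  qed
  also have "(\<Sum>a<n. 2 * (J a i * y a)) = (\<Sum>b<n. 2 * (J i b * y b))"
    using i sym[of i] by (intro sum.cong refl) auto
  finally show ?thesis by (simp add: sum_distrib_left[symmetric])
qed

lemma abs_tanh_diff_le: "\<bar>tanh a - tanh b\<bar> \<le> \<bar>a - b\<bar>" for a b :: real
proof -
  have *: "tanh v - tanh u \<le> v - u" if "u \<le> v" for u v :: real
  proof -
    have "(\<lambda>z. z - tanh z) u \<le> (\<lambda>z. z - tanh z) v"
    proof (rule DERIV_nonneg_imp_nondecreasing[OF that])
      fix z :: real
      have "((\<lambda>z. z - tanh z) has_real_derivative (tanh z)\<^sup>2) (at z)"
        by (auto intro!: derivative_eq_intros simp: cosh_real_pos less_imp_neq[symmetric])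
      then show "\<exists>D. ((\<lambda>z. z - tanh z) has_real_derivative D) (at z) \<and> 0 \<le> D"
        by (intro exI[of _ "(tanh z)\<^sup>2"]) auto
    qed
    then show ?thesis by simp
  qed
  show ?thesis
    using *[of a b] *[of b a] by (cases "a \<le> b") (auto simp: abs_if)
qed

locale ising =
  fixes n :: nat and J :: "nat \<Rightarrow> nat \<Rightarrow> real" and h :: "nat \<Rightarrow> real" and \<alpha> \<alpha>' :: real
  assumes alpha_pos: "0 < \<alpha>" and alpha_le: "\<alpha> \<le> 1"
    and J_sym: "\<And>i j. i < n \<Longrightarrow> j < n \<Longrightarrow> J i j = J j i"
    and J_diag: "\<And>i. i < n \<Longrightarrow> J i i = 0"
    and J_row: "\<And>i. i < n \<Longrightarrow> (\<Sum>j<n. \<bar>J i j\<bar>) \<le> 1 - \<alpha>"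
    and h_bound: "\<And>i. i < n \<Longrightarrow> \<bar>h i\<bar> \<le> \<alpha>'"
begin

abbreviation "W \<equiv> gibbs_weight n J h"
abbreviation "x0 \<equiv> (\<lambda>_. undefined) :: nat \<Rightarrow> real"
abbreviation "E \<equiv> qE n J h"

text \<open>Flipping spin i from -1 to 1 multiplies the weight by exp (2 \<theta>), where \<theta>
  is the local field, and (exp (2 \<theta>) - 1) / (exp (2 \<theta>) + 1) = tanh \<theta>.\<close>

lemma mag_gibbs:
  assumes i: "i < n"
  shows "mag W i y = tanh (h i + (\<Sum>j<n. J i j * y j))"
proof -
  let ?X = "\<lambda>y. (1/2) * (\<Sum>a<n. \<Sum>b<n. J a b * y a * y b) + (\<Sum>a<n. h a * y a)"
  let ?\<theta> = "h i + (\<Sum>j<n. J i j * y j)"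
  have ne: "y(i := 1) \<noteq> y(i := -1)" by (metis fun_upd_same one_neq_neg_one)
  have "(\<Sum>a<n. h a * (y(i := 1)) a) - (\<Sum>a<n. h a * (y(i := -1)) a) = (\<Sum>a<n. if a = i then 2 * h i else 0)"
    unfolding sum_subtractf[symmetric] by (intro sum.cong refl) auto
  then have "?X (y(i := 1)) - ?X (y(i := -1)) = 2 * ?\<theta>"
    using quadratic_form_diff[of i n J y] J_sym J_diag i by (simp add: sum.delta)
  then have X: "?X (y(i := 1)) = ?X (y(i := -1)) + 2 * ?\<theta>" by linarith
  define t where "t = exp ?\<theta>"
  define u where "u = exp (?X (y(i := -1)))"
  have t: "0 < t" "0 < u" by (auto simp: t_def u_def)
  have w1: "W (y(i := 1)) = u * t\<^sup>2"
    unfolding gibbs_weight_def X u_def t_def by (simp only: exp_add[of _ "2 * _"] exp_double)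
  have w2: "W (y(i := -1)) = u"
    unfolding gibbs_weight_def u_def ..
  have "mag W i y = (u * t\<^sup>2 - u) / (u * t\<^sup>2 + u)"
    using ne unfolding mag_def cE_def cfg_single by (simp add: w1 w2)
  also have "\<dots> = (u * t) * (t - inverse t) / ((u * t) * (t + inverse t))"
  proof -
    have "u * t\<^sup>2 - u = (u * t) * (t - inverse t)" "u * t\<^sup>2 + u = (u * t) * (t + inverse t)"
      using t by (simp_all add: right_diff_distrib distrib_left power2_eq_square)
    then show ?thesis by (simp only:)
  qed
  also have "\<dots> = (t - inverse t) / (t + inverse t)"
    using t by (intro mult_divide_mult_cancel_left) auto
  also have "\<dots> = tanh ?\<theta>"
    unfolding tanh_altdef t_def exp_minus ..
  finally show ?thesis .
qed

text \<open>Flipping j moves the local field at i by \<open>2 * J i j\<close>, and tanh is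
  1-Lipschitz, so \<open>\<bar>J i j\<bar>\<close> dominates the influence. The field is at most
  \<alpha>' + 1 in absolute value; the resulting variance bound depends on \<alpha>' alone and not
  on n, J or h.\<close>

sublocale dobrushin "{..<n}" x0 W "\<lambda>i j. \<bar>J i j\<bar>" \<alpha> "1 - (tanh (\<alpha>' + 1))\<^sup>2"
proof
  show "0 < 1 - (tanh (\<alpha>' + 1))\<^sup>2"
    using tanh_real_bounds[of "\<alpha>' + 1"] by (simp add: abs_square_less_1 abs_less_iff)
  show "1 - (tanh (\<alpha>' + 1))\<^sup>2 \<le> 1 - (mag W i y)\<^sup>2" if "i \<in> {..<n}" "y \<in> cfg {..<n} x0" for i y
  proof -
    let ?\<theta> = "h i + (\<Sum>j<n. J i j * y j)"
    have "\<bar>\<Sum>j<n. J i j * y j\<bar> \<le> (\<Sum>j<n. \<bar>J i j\<bar>)"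
      using cfg_spin[OF that(2)] by (intro order_trans[OF sum_abs] sum_mono) (force simp: abs_mult)
    then have "\<bar>?\<theta>\<bar> \<le> \<alpha>' + 1"
      using h_bound[of i] J_row[of i] that alpha_pos by auto
    then have "tanh \<bar>?\<theta>\<bar> \<le> tanh (\<alpha>' + 1)" by (simp only: tanh_real_le_iff)
    then have "\<bar>tanh ?\<theta>\<bar>\<^sup>2 \<le> (tanh (\<alpha>' + 1))\<^sup>2"
      unfolding tanh_real_abs by (intro power_mono) auto
    then show ?thesis using that by (simp add: mag_gibbs)
  qed
  show "\<bar>spin_diff j (mag W i) y\<bar> \<le> \<bar>J i j\<bar>" if "i \<in> {..<n}" "j \<in> {..<n}" for i j y
  proof -
    let ?\<theta> = "\<lambda>y. h i + (\<Sum>j<n. J i j * y j)"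
    have "?\<theta> (y(j := 1)) - ?\<theta> (y(j := -1)) = (\<Sum>k<n. if k = j then 2 * J i j else 0)"
      unfolding add_diff_cancel_left sum_subtractf[symmetric] by (intro sum.cong refl) auto
    also have "\<dots> = 2 * J i j" using that by (simp add: sum.delta)
    finally show ?thesis
      using abs_tanh_diff_le[of "?\<theta> (y(j := 1))" "?\<theta> (y(j := -1))"] that
      by (simp only: spin_diff_def mag_gibbs lessThan_iff abs_divide) (simp add: abs_mult)
  qed
qed (use gibbs_weight_pos alpha_pos alpha_le J_sym J_row in auto)

lemma E_add: "E (\<lambda>y. F y + G y) = E F + E G"
  and E_diff: "E (\<lambda>y. F y - G y) = E F - E G"
  and E_cmult: "E (\<lambda>y. k * F y) = k * E F"
  and E_cmult_right: "E (\<lambda>y. F y * k) = E F * k"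
  and E_sum: "E (\<lambda>y. \<Sum>a\<in>I. G' a y) = (\<Sum>a\<in>I. E (G' a))"
  and E_const: "E (\<lambda>y. k) = k"
  by (simp_all add: qE_eq_cE cE_add[OF w_pos] cE_diff[OF w_pos] cE_cmult[OF w_pos]
      cE_cmult_right[OF w_pos] cE_sum[OF w_pos] cE_const[OF w_pos])

lemma E_xt: "E (xt n J h i) = 0"
  unfolding xt_def[abs_def] E_diff E_const by simp

lemma E_xtp: "E (xtp n J h is) = ext n J h is"
  by (simp add: ext_def)

text \<open>Every tensor entry multiplies a centered expression; for d = 4 the constant with
  coefficient 6 cancels the mean of the quadratic correction.\<close>

lemma E_fdA: "d \<in> {1, 2, 3, 4} \<Longrightarrow> E (fdA n J h d A) = 0"
  unfolding fdA_def[abs_def]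
  by (auto simp: E_sum E_cmult E_cmult_right E_diff E_add E_const E_xt E_xtp mult.assoc)

end

section \<open>Symmetric tensors, their slices, and sums over index tuples\<close>

lemma tensor_mset_cong:
  assumes "sym_tensor n d A" "l \<in> index_tuples n d" "mset js = mset l"
  shows "A js = A l"
proof -
  obtain p where p: "p permutes {..<length l}" "permute_list p l = js"
    using mset_eq_permutation[OF assms(3)] by blast
  have "length l = d" using assms(2) by (simp add: index_tuples_def)
  then show ?thesis
    using assms(1,2) p by (auto simp: sym_tensor_def permute_list_def)
qed

lemma tensor_mset_congI:
  assumes "\<And>l js. l \<in> index_tuples n d \<Longrightarrow> mset js = mset l \<Longrightarrow> A js = A l"
  shows "sym_tensor n d A"
  unfolding sym_tensor_def
proof (intro ballI allI impI)
  fix l \<pi> assume l: "l \<in> index_tuples n d" and \<pi>: "\<pi> permutes {..<d}"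
  have "mset (permute_list \<pi> l) = mset l"
    using l \<pi> by (intro mset_permute_list) (simp add: index_tuples_def)
  then have "A (permute_list \<pi> l) = A l" by (rule assms[OF l])
  then show "A l = A (map (\<lambda>k. l ! \<pi> k) [0..<d])"
    using l by (simp add: permute_list_def index_tuples_def)
qed

lemma Cons_index_tuples: "i < n \<Longrightarrow> l \<in> index_tuples n d \<Longrightarrow> i # l \<in> index_tuples n (Suc d)"
  by (simp add: index_tuples_def)

lemma sym_tensor_slice:
  assumes "sym_tensor n (Suc d) A" "i < n"
  shows "sym_tensor n d (\<lambda>l. A (i # l))"
  by (intro tensor_mset_congI tensor_mset_cong[OF assms(1)] Cons_index_tuples assms(2)) auto

lemma vanishing_diag_slice:
  assumes "vanishing_diag n (Suc d) A" "i < n"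
  shows "vanishing_diag n d (\<lambda>l. A (i # l))"
  unfolding vanishing_diag_def
proof (intro ballI impI)
  fix l assume l: "l \<in> index_tuples n d" "card (set l) < d"
  have "card (set (i # l)) < Suc d"
    using l card_insert_le_m1[of "Suc d" "set l" i] by (simp add: card_insert_if)
  then show "A (i # l) = 0"
    using assms Cons_index_tuples[OF assms(2) l(1)] unfolding vanishing_diag_def by blast
qed

lemma finite_index_tuples [simp]: "finite (index_tuples n d)"
  using finite_lists_length_eq[of "{..<n}" d] by (simp add: index_tuples_def conj_commute)

lemma index_tuples_Suc: "index_tuples n (Suc d) = (\<lambda>(i, l). i # l) ` ({..<n} \<times> index_tuples n d)"
  by (force simp: index_tuples_def length_Suc_conv)

lemma sum_index_tuples_Suc:
  "(\<Sum>l\<in>index_tuples n (Suc d). F l) = (\<Sum>i<n. \<Sum>l\<in>index_tuples n d. F (i # l))"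
proof -
  have "inj_on (\<lambda>(i, l). i # l) ({..<n} \<times> index_tuples n d)" by (auto simp: inj_on_def)
  then show ?thesis
    unfolding index_tuples_Suc by (simp add: sum.reindex sum.cartesian_product split_def)
qed

lemma index_tuples_0: "index_tuples n 0 = {[]}"
  by (auto simp: index_tuples_def)

section \<open>Polynomials and their differences\<close>

lemma spin_diff_sum: "spin_diff i (\<lambda>y. \<Sum>a\<in>I. F a y) y = (\<Sum>a\<in>I. spin_diff i (F a) y)"
  by (simp add: spin_diff_def sum_subtractf sum_divide_distrib[symmetric])

lemma spin_diff_cmult: "spin_diff i (\<lambda>y. k * F y) y = k * spin_diff i F y"
  by (simp add: spin_diff_def algebra_simps)

lemma xt_fun_upd: "xt n J h j (y(i := s)) = (if j = i then s - qE n J h (\<lambda>\<tau>. \<tau> i) else xt n J h j y)"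
  by (simp add: xt_def)

lemma sum_if_const: "(\<Sum>a\<in>I. if P then F a else 0) = (if P then (\<Sum>a\<in>I. F a) else 0)"
  by simp

context ising
begin

abbreviation "X \<equiv> xt n J h"
abbreviation "f \<equiv> fdA n J h"

lemma spin_diff_fdA_1:
  assumes i: "i < n"
  shows "spin_diff i (f 1 A) y = A [i]"
proof -
  have "spin_diff i (f 1 A) y = (\<Sum>j<n. A [j] * spin_diff i (X j) y)"
    unfolding fdA_def[abs_def] by (simp add: spin_diff_sum spin_diff_cmult)
  also have "\<dots> = (\<Sum>j<n. if j = i then A [i] else 0)"
    by (intro sum.cong refl) (simp add: spin_diff_def xt_fun_upd)
  finally show ?thesis using i by (simp add: sum.delta)
qed

lemma spin_diff_fdA_2:
  assumes i: "i < n" and sym: "sym_tensor n 2 A" and diag: "vanishing_diag n 2 A"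
  shows "spin_diff i (f 2 A) y = 2 * f 1 (\<lambda>l. A (i # l)) y"
proof -
  have swap: "A [j, i] = A [i, j]" if "j < n" for j
    using that i by (intro tensor_mset_cong[OF sym]) (auto simp: index_tuples_def)
  have zero: "A [j, j] = 0" if "j < n" for j
    using diag that by (auto simp: vanishing_diag_def index_tuples_def)
  have "spin_diff i (f 2 A) y
      = (\<Sum>j<n. \<Sum>k<n. A [j, k] * spin_diff i (\<lambda>y. xtp n J h [j, k] y - ext n J h [j, k]) y)"
    unfolding fdA_def[abs_def] by (simp add: spin_diff_sum spin_diff_cmult)
  also have "\<dots> = (\<Sum>j<n. \<Sum>k<n. (if j = i then A [i, k] * X k y else 0)
      + (if k = i then A [j, i] * X j y else 0))"
    by (intro sum.cong refl) (auto simp: spin_diff_def xt_fun_upd xtp_def zero field_simps)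
  also have "\<dots> = (\<Sum>k<n. A [i, k] * X k y) + (\<Sum>j<n. A [j, i] * X j y)"
    using i by (simp add: sum.distrib sum_if_const)
  also have "(\<Sum>j<n. A [j, i] * X j y) = (\<Sum>k<n. A [i, k] * X k y)"
    by (intro sum.cong refl) (simp add: swap)
  also have "(\<Sum>k<n. A [i, k] * X k y) + (\<Sum>k<n. A [i, k] * X k y) = 2 * f 1 (\<lambda>l. A (i # l)) y"
    by (simp add: fdA_def)
  finally show ?thesis .
qed

text \<open>The vanishing diagonal leaves only tuples in which at most one index equals i, and
  symmetry makes the three positions contribute equally. The linear correction is hit only at j = i;
  its coefficient 3 is shared out among the three copies, giving each the mean that centers
  it.\<close>

lemma spin_diff_fdA_3:
  assumes i: "i < n" and sym: "sym_tensor n 3 A" and diag: "vanishing_diag n 3 A"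
  shows "spin_diff i (f 3 A) y = 3 * f 2 (\<lambda>l. A (i # l)) y"
proof -
  let ?e = "\<lambda>k l. ext n J h [k, l]"
  have swap: "A [j, i, k] = A [i, j, k]" "A [j, k, i] = A [i, j, k]" if "j < n" "k < n" for j k
    using that i by (auto intro!: tensor_mset_cong[OF sym] simp: index_tuples_def)
  have zero: "A [j, j, k] = 0" "A [j, k, j] = 0" "A [k, j, j] = 0" if "j < n" "k < n" for j k
    using diag that by (auto simp: vanishing_diag_def index_tuples_def card_insert_if)
  have "spin_diff i (f 3 A) y = (\<Sum>j<n. \<Sum>k<n. \<Sum>l<n. A [j, k, l] *
      spin_diff i (\<lambda>y. xtp n J h [j, k, l] y - ext n J h [j, k, l] - 3 * X j y * ?e k l) y)"
    unfolding fdA_def[abs_def] by (simp add: spin_diff_sum spin_diff_cmult)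
  also have "\<dots> = (\<Sum>j<n. \<Sum>k<n. \<Sum>l<n.
        (if j = i then A [i, k, l] * (X k y * X l y - 3 * ?e k l) else 0)
      + (if k = i then A [j, i, l] * (X j y * X l y) else 0)
      + (if l = i then A [j, k, i] * (X j y * X k y) else 0))"
    by (intro sum.cong refl) (auto simp: spin_diff_def xt_fun_upd xtp_def zero field_simps)
  also have "\<dots> = (\<Sum>k<n. \<Sum>l<n. A [i, k, l] * (X k y * X l y - 3 * ?e k l))
      + (\<Sum>j<n. \<Sum>l<n. A [j, i, l] * (X j y * X l y)) + (\<Sum>j<n. \<Sum>k<n. A [j, k, i] * (X j y * X k y))"
    using i by (simp add: sum.distrib sum_if_const)
  also have "(\<Sum>j<n. \<Sum>l<n. A [j, i, l] * (X j y * X l y)) = (\<Sum>k<n. \<Sum>l<n. A [i, k, l] * (X k y * X l y))"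
    by (intro sum.cong refl) (simp add: swap)
  also have "(\<Sum>j<n. \<Sum>k<n. A [j, k, i] * (X j y * X k y)) = (\<Sum>k<n. \<Sum>l<n. A [i, k, l] * (X k y * X l y))"
    by (intro sum.cong refl) (simp add: swap)
  also have "(\<Sum>k<n. \<Sum>l<n. A [i, k, l] * (X k y * X l y - 3 * ?e k l))
      + (\<Sum>k<n. \<Sum>l<n. A [i, k, l] * (X k y * X l y)) + (\<Sum>k<n. \<Sum>l<n. A [i, k, l] * (X k y * X l y))
      = 3 * f 2 (\<lambda>l. A (i # l)) y"
    by (simp add: fdA_def xtp_def sum_distrib_left sum.distrib[symmetric] algebra_simps)
  finally show ?thesis .
qed

text \<open>As in degree three, now with four positions. The cubic mean with coefficient 4 is hit
  once and gives 4 * 1. The quadratic correction with coefficient 6 is hit at two positions and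
  gives 12 = 4 * 3, the linear correction required in degree three.\<close>

lemma spin_diff_fdA_4:
  assumes i: "i < n" and sym: "sym_tensor n 4 A" and diag: "vanishing_diag n 4 A"
  shows "spin_diff i (f 4 A) y = 4 * f 3 (\<lambda>l. A (i # l)) y"
proof -
  let ?e = "\<lambda>k l. ext n J h [k, l]" and ?e3 = "\<lambda>j k l. ext n J h [j, k, l]"
  have swap: "A [j, i, k, l] = A [i, j, k, l]" "A [j, k, i, l] = A [i, j, k, l]"
      "A [j, k, l, i] = A [i, j, k, l]" if "j < n" "k < n" "l < n" for j k l
    using that i by (auto intro!: tensor_mset_cong[OF sym] simp: index_tuples_def)
  have zero: "A [j, j, k, l] = 0" "A [j, k, j, l] = 0" "A [j, k, l, j] = 0"
      "A [k, j, j, l] = 0" "A [k, j, l, j] = 0" "A [k, l, j, j] = 0" if "j < n" "k < n" "l < n" for j k l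
    using diag that by (auto simp: vanishing_diag_def index_tuples_def card_insert_if)
  have "spin_diff i (f 4 A) y = (\<Sum>j<n. \<Sum>k<n. \<Sum>l<n. \<Sum>m<n. A [j, k, l, m] *
      spin_diff i (\<lambda>y. xtp n J h [j, k, l, m] y - ext n J h [j, k, l, m] - 4 * X j y * ?e3 k l m
        - 6 * xtp n J h [j, k] y * ?e l m + 6 * ?e j k * ?e l m) y)"
    unfolding fdA_def[abs_def] by (simp add: spin_diff_sum spin_diff_cmult)
  also have "\<dots> = (\<Sum>j<n. \<Sum>k<n. \<Sum>l<n. \<Sum>m<n.
        (if j = i then A [i, k, l, m] * (X k y * X l y * X m y - 4 * ?e3 k l m - 6 * X k y * ?e l m) else 0)
      + (if k = i then A [j, i, l, m] * (X j y * X l y * X m y - 6 * X j y * ?e l m) else 0)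
      + (if l = i then A [j, k, i, m] * (X j y * X k y * X m y) else 0)
      + (if m = i then A [j, k, l, i] * (X j y * X k y * X l y) else 0))"
  proof (intro sum.cong refl)
    fix j k l m assume *: "j \<in> {..<n}" "k \<in> {..<n}" "l \<in> {..<n}" "m \<in> {..<n}"
    show "A [j, k, l, m] *
      spin_diff i (\<lambda>y. xtp n J h [j, k, l, m] y - ext n J h [j, k, l, m] - 4 * X j y * ?e3 k l m
        - 6 * xtp n J h [j, k] y * ?e l m + 6 * ?e j k * ?e l m) y
      = (if j = i then A [i, k, l, m] * (X k y * X l y * X m y - 4 * ?e3 k l m - 6 * X k y * ?e l m) else 0)
      + (if k = i then A [j, i, l, m] * (X j y * X l y * X m y - 6 * X j y * ?e l m) else 0)
      + (if l = i then A [j, k, i, m] * (X j y * X k y * X m y) else 0)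
      + (if m = i then A [j, k, l, i] * (X j y * X k y * X l y) else 0)"
    proof (cases "distinct [j, k, l, m]")
      case True
      then show ?thesis
        by (cases "j = i"; cases "k = i"; cases "l = i"; cases "m = i")
          (simp_all add: spin_diff_def xt_fun_upd xtp_def field_simps)
    next
      case False
      then show ?thesis using * by (auto simp: zero)
    qed
  qed
  also have "\<dots> = (\<Sum>k<n. \<Sum>l<n. \<Sum>m<n. A [i, k, l, m] * (X k y * X l y * X m y - 4 * ?e3 k l m - 6 * X k y * ?e l m))
      + (\<Sum>j<n. \<Sum>l<n. \<Sum>m<n. A [j, i, l, m] * (X j y * X l y * X m y - 6 * X j y * ?e l m))
      + (\<Sum>j<n. \<Sum>k<n. \<Sum>m<n. A [j, k, i, m] * (X j y * X k y * X m y))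
      + (\<Sum>j<n. \<Sum>k<n. \<Sum>l<n. A [j, k, l, i] * (X j y * X k y * X l y))"
    using i by (simp add: sum.distrib sum_if_const)
  also have "(\<Sum>j<n. \<Sum>l<n. \<Sum>m<n. A [j, i, l, m] * (X j y * X l y * X m y - 6 * X j y * ?e l m))
      = (\<Sum>k<n. \<Sum>l<n. \<Sum>m<n. A [i, k, l, m] * (X k y * X l y * X m y - 6 * X k y * ?e l m))"
    by (intro sum.cong refl) (simp add: swap)
  also have "(\<Sum>j<n. \<Sum>k<n. \<Sum>m<n. A [j, k, i, m] * (X j y * X k y * X m y))
      = (\<Sum>k<n. \<Sum>l<n. \<Sum>m<n. A [i, k, l, m] * (X k y * X l y * X m y))"
    by (intro sum.cong refl) (simp add: swap)
  also have "(\<Sum>j<n. \<Sum>k<n. \<Sum>l<n. A [j, k, l, i] * (X j y * X k y * X l y))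
      = (\<Sum>k<n. \<Sum>l<n. \<Sum>m<n. A [i, k, l, m] * (X k y * X l y * X m y))"
    by (intro sum.cong refl) (simp add: swap)
  also have "(\<Sum>k<n. \<Sum>l<n. \<Sum>m<n. A [i, k, l, m] * (X k y * X l y * X m y - 4 * ?e3 k l m - 6 * X k y * ?e l m))
      + (\<Sum>k<n. \<Sum>l<n. \<Sum>m<n. A [i, k, l, m] * (X k y * X l y * X m y - 6 * X k y * ?e l m))
      + (\<Sum>k<n. \<Sum>l<n. \<Sum>m<n. A [i, k, l, m] * (X k y * X l y * X m y))
      + (\<Sum>k<n. \<Sum>l<n. \<Sum>m<n. A [i, k, l, m] * (X k y * X l y * X m y))
      = 4 * f 3 (\<lambda>l. A (i # l)) y"
    by (simp add: fdA_def xtp_def sum_distrib_left sum.distrib[symmetric] algebra_simps)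
  finally show ?thesis .
qed

text \<open>The lower-order corrections in the definition of the polynomials are chosen such that
  differences of the polynomials are again centered polynomials of this form.\<close>

lemma spin_diff_fdA_Suc:
  assumes "Suc d \<in> {2, 3, 4}" "i < n" "sym_tensor n (Suc d) A" "vanishing_diag n (Suc d) A"
  shows "spin_diff i (f (Suc d) A) y = real (Suc d) * f d (\<lambda>l. A (i # l)) y"
proof -
  consider "Suc d = 2" | "Suc d = 3" | "Suc d = 4" using assms(1) by auto
  then show ?thesis
  proof cases
    case 1
    then have "d = 1" by simp
    then show ?thesis using spin_diff_fdA_2[of i A y] assms by (simp add: numeral_2_eq_2)
  next
    case 2
    then have "d = 2" by simp
    then show ?thesis using spin_diff_fdA_3[of i A y] assms by (simp add: numeral_3_eq_3)
  next
    case 3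
    then have "d = 3" by simp
    then show ?thesis using spin_diff_fdA_4[of i A y] assms by simp
  qed
qed

lemma cube_moments:
  fixes A :: "'a \<Rightarrow> nat list \<Rightarrow> real"
  assumes "d \<in> {1, 2, 3, 4}"
  shows "E (\<lambda>y. (\<Sum>a\<in>I. (f d (A a) y)\<^sup>2) ^ (2 ^ k))
    \<le> (2 * moment_const * 2 ^ k) ^ (2 ^ k)
      * E (\<lambda>y. (\<Sum>a\<in>I. \<Sum>i<n. (spin_diff i (f d (A a)) y)\<^sup>2) ^ (2 ^ k))"
  using vector_moments[of I "\<lambda>a. f d (A a)" k] E_fdA[OF assms] by (simp add: qE_eq_cE)

text \<open>The statement concerns families of tensors because differentiation turns a family
  indexed by a into one indexed by pairs (a, i). Every differentiation contributes one factor of the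
  moment bound and the square of the current degree, whence the power d and the squared
  factorial.\<close>

lemma chaos_moments:
  fixes I :: "nat set" and A :: "nat \<Rightarrow> nat list \<Rightarrow> real"
  assumes "d \<in> {1, 2, 3, 4}"
    and "\<And>a. a \<in> I \<Longrightarrow> sym_tensor n d (A a)" "\<And>a. a \<in> I \<Longrightarrow> vanishing_diag n d (A a)"
  shows "E (\<lambda>y. (\<Sum>a\<in>I. (f d (A a) y)\<^sup>2) ^ (2 ^ k))
    \<le> ((2 * moment_const * 2 ^ k) ^ d * (fact d)\<^sup>2
      * (\<Sum>a\<in>I. \<Sum>l\<in>index_tuples n d. (A a l)\<^sup>2)) ^ (2 ^ k)"
  using assms
proof (induction d arbitrary: I A)
  case 0
  then show ?case by simp
next
  case (Suc d)
  let ?K = "2 * moment_const * 2 ^ k"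
  have K: "0 \<le> ?K" using moment_const_pos by simp
  show ?case
  proof (cases "d = 0")
    case True
    \<comment> \<open>The differences of a linear form are its constant coefficients; here the
      iteration ends.\<close>
    have "E (\<lambda>y. (\<Sum>a\<in>I. (f 1 (A a) y)\<^sup>2) ^ (2 ^ k))
        \<le> ?K ^ (2 ^ k) * E (\<lambda>y. (\<Sum>a\<in>I. \<Sum>i<n. (A a [i])\<^sup>2) ^ (2 ^ k))"
      using cube_moments[of 1 A I k] by (simp add: spin_diff_fdA_1 del: One_nat_def)
    then show ?thesis
      using True by (simp add: E_const power_mult_distrib sum_index_tuples_Suc index_tuples_0)
  next
    case False
    \<comment> \<open>Pairs are encoded as natural numbers so that the index type stays the same
      throughout the induction.\<close>
    define I' where "I' = prod_encode ` (I \<times> {..<n})"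
    define A' where "A' p = (\<lambda>l. A (fst (prod_decode p)) (snd (prod_decode p) # l))" for p
    have sum_I': "(\<Sum>p\<in>I'. G (prod_decode p)) = (\<Sum>a\<in>I. \<Sum>i<n. G (a, i))" for G :: "nat \<times> nat \<Rightarrow> real"
      unfolding I'_def by (simp add: sum.reindex inj_prod_encode sum.cartesian_product)
    have d: "d \<in> {1, 2, 3, 4}" using Suc.prems(1) False by auto
    have derivs: "(\<Sum>a\<in>I. \<Sum>i<n. (spin_diff i (f (Suc d) (A a)) y)\<^sup>2)
        = (real (Suc d))\<^sup>2 * (\<Sum>p\<in>I'. (f d (A' p) y)\<^sup>2)" for y
    proof -
      have "(\<Sum>a\<in>I. \<Sum>i<n. (spin_diff i (f (Suc d) (A a)) y)\<^sup>2)
          = (\<Sum>a\<in>I. \<Sum>i<n. (real (Suc d) * f d (\<lambda>l. A a (i # l)) y)\<^sup>2)"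
      proof (intro sum.cong refl)
        fix a i assume "a \<in> I" "i \<in> {..<n}"
        then have "spin_diff i (f (Suc d) (A a)) y = real (Suc d) * f d (\<lambda>l. A a (i # l)) y"
          using Suc.prems False by (intro spin_diff_fdA_Suc) auto
        then show "(spin_diff i (f (Suc d) (A a)) y)\<^sup>2 = (real (Suc d) * f d (\<lambda>l. A a (i # l)) y)\<^sup>2"
          by (rule arg_cong)
      qed
      also have "\<dots> = (real (Suc d))\<^sup>2 * (\<Sum>a\<in>I. \<Sum>i<n. (f d (\<lambda>l. A a (i # l)) y)\<^sup>2)"
        by (simp only: power_mult_distrib sum_distrib_left)
      also have "(\<Sum>a\<in>I. \<Sum>i<n. (f d (\<lambda>l. A a (i # l)) y)\<^sup>2) = (\<Sum>p\<in>I'. (f d (A' p) y)\<^sup>2)"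
        using sum_I'[of "\<lambda>(a, i). (f d (\<lambda>l. A a (i # l)) y)\<^sup>2"] by (simp add: A'_def split_def)
      finally show ?thesis .
    qed
    let ?s = "\<Sum>a\<in>I. \<Sum>l\<in>index_tuples n (Suc d). (A a l)\<^sup>2"
    have s: "(\<Sum>p\<in>I'. \<Sum>l\<in>index_tuples n d. (A' p l)\<^sup>2) = ?s"
      using sum_I'[of "\<lambda>(a, i). \<Sum>l\<in>index_tuples n d. (A a (i # l))\<^sup>2"]
      by (simp add: A'_def split_def sum_index_tuples_Suc)
    have IH: "E (\<lambda>y. (\<Sum>p\<in>I'. (f d (A' p) y)\<^sup>2) ^ (2 ^ k)) \<le> (?K ^ d * (fact d)\<^sup>2 * ?s) ^ (2 ^ k)"
      unfolding s[symmetric]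
    proof (rule Suc.IH[OF d])
      fix p assume "p \<in> I'"
      then obtain a i where "p = prod_encode (a, i)" "a \<in> I" "i < n" by (auto simp: I'_def)
      then show "sym_tensor n d (A' p)" "vanishing_diag n d (A' p)"
        using Suc.prems by (auto simp: A'_def intro: sym_tensor_slice vanishing_diag_slice)
    qed
    have "E (\<lambda>y. (\<Sum>a\<in>I. (f (Suc d) (A a) y)\<^sup>2) ^ (2 ^ k))
        \<le> ?K ^ (2 ^ k) * E (\<lambda>y. (\<Sum>a\<in>I. \<Sum>i<n. (spin_diff i (f (Suc d) (A a)) y)\<^sup>2) ^ (2 ^ k))"
      using Suc.prems(1) by (rule cube_moments)
    also have "\<dots> = ?K ^ (2 ^ k) * (((real (Suc d))\<^sup>2) ^ (2 ^ k) * E (\<lambda>y. (\<Sum>p\<in>I'. (f d (A' p) y)\<^sup>2) ^ (2 ^ k)))"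
      by (simp only: derivs power_mult_distrib E_cmult)
    also have "\<dots> \<le> ?K ^ (2 ^ k) * (((real (Suc d))\<^sup>2) ^ (2 ^ k) * (?K ^ d * (fact d)\<^sup>2 * ?s) ^ (2 ^ k))"
      using IH K by (intro mult_left_mono) auto
    also have "\<dots> = (?K * ((real (Suc d))\<^sup>2 * (?K ^ d * (fact d)\<^sup>2 * ?s))) ^ (2 ^ k)"
      by (simp only: power_mult_distrib)
    also have "?K * ((real (Suc d))\<^sup>2 * (?K ^ d * (fact d)\<^sup>2 * ?s)) = ?K ^ Suc d * (fact (Suc d))\<^sup>2 * ?s"
      unfolding fact_Suc power_mult_distrib[of "of_nat (Suc d)" "fact d :: real"] by (simp only: power_Suc mult_ac)
    finally show ?thesis .
  qed
qed

end

section \<open>Tail bounds\<close>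

lemma partition_fn_pos: "0 < partition_fn n J h"
  unfolding partition_fn_def cube_eq_cfg by (rule part_pos[OF gibbs_weight_pos]) simp

lemma qprob_le_1: "qprob n J h P \<le> 1"
proof -
  have "(\<Sum>\<sigma>\<in>{\<sigma> \<in> cube n. P \<sigma>}. gibbs_weight n J h \<sigma>) \<le> partition_fn n J h"
    unfolding partition_fn_def using gibbs_weight_pos
    by (intro sum_mono2) (auto simp: cube_eq_cfg intro: less_imp_le)
  then show ?thesis using partition_fn_pos by (simp add: qprob_def)
qed

lemma qprob_markov:
  assumes t: "0 < t"
  shows "qprob n J h (\<lambda>\<sigma>. \<bar>F \<sigma>\<bar> > t) \<le> qE n J h (\<lambda>\<sigma>. ((F \<sigma>)\<^sup>2) ^ N) / (t\<^sup>2) ^ N"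
proof -
  let ?w = "gibbs_weight n J h"
  have "(\<Sum>\<sigma>\<in>{\<sigma> \<in> cube n. \<bar>F \<sigma>\<bar> > t}. ?w \<sigma>)
      \<le> (\<Sum>\<sigma>\<in>{\<sigma> \<in> cube n. \<bar>F \<sigma>\<bar> > t}. ?w \<sigma> * ((F \<sigma>)\<^sup>2) ^ N / (t\<^sup>2) ^ N)"
  proof (rule sum_mono)
    fix \<sigma> assume "\<sigma> \<in> {\<sigma> \<in> cube n. \<bar>F \<sigma>\<bar> > t}"
    then have "t\<^sup>2 \<le> \<bar>F \<sigma>\<bar>\<^sup>2" using t by (intro power_mono) auto
    then have "t\<^sup>2 \<le> (F \<sigma>)\<^sup>2" by simp
    then have "(t\<^sup>2) ^ N \<le> ((F \<sigma>)\<^sup>2) ^ N" by (rule power_mono) simp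
    then have "?w \<sigma> * (t\<^sup>2) ^ N \<le> ?w \<sigma> * ((F \<sigma>)\<^sup>2) ^ N"
      using gibbs_weight_pos by (intro mult_left_mono) (auto intro: less_imp_le)
    then show "?w \<sigma> \<le> ?w \<sigma> * ((F \<sigma>)\<^sup>2) ^ N / (t\<^sup>2) ^ N"
      using t by (simp add: pos_le_divide_eq)
  qed
  also have "\<dots> \<le> (\<Sum>\<sigma>\<in>cube n. ?w \<sigma> * ((F \<sigma>)\<^sup>2) ^ N / (t\<^sup>2) ^ N)"
    by (intro sum_mono2) (auto simp: cube_eq_cfg intro!: divide_nonneg_nonneg mult_nonneg_nonneg less_imp_le[OF gibbs_weight_pos])
  finally have "(\<Sum>\<sigma>\<in>{\<sigma> \<in> cube n. \<bar>F \<sigma>\<bar> > t}. ?w \<sigma>)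
      \<le> (\<Sum>\<sigma>\<in>cube n. ?w \<sigma> * ((F \<sigma>)\<^sup>2) ^ N) / (t\<^sup>2) ^ N"
    by (simp add: sum_divide_distrib)
  then have "qprob n J h (\<lambda>\<sigma>. \<bar>F \<sigma>\<bar> > t)
      \<le> ((\<Sum>\<sigma>\<in>cube n. ?w \<sigma> * ((F \<sigma>)\<^sup>2) ^ N) / (t\<^sup>2) ^ N) / partition_fn n J h"
    unfolding qprob_def using partition_fn_pos by (intro divide_right_mono) (auto intro: less_imp_le)
  then show ?thesis by (simp add: qE_def mult.commute)
qed

lemma dyadic_between:
  fixes r :: real
  assumes "1 \<le> r"
  obtains k :: nat where "2 ^ k \<le> r" "r < 2 * 2 ^ k"
proof -
  obtain m :: nat where m: "r < 2 ^ m" using real_arch_pow[of 2 r] by auto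
  obtain k where "\<forall>i\<le>k. \<not> r < 2 ^ i" "r < 2 ^ Suc k"
    using ex_least_nat_less[of "\<lambda>i. r < 2 ^ i" m] m assms by auto
  then show ?thesis using that[of k] by (auto simp: not_less)
qed

lemma hs_norm_nonneg: "0 \<le> hs_norm n d A"
  by (simp add: hs_norm_def sum_nonneg)

text \<open>There are n^d index tuples; the exponent 1 / d applied to the squared norm turns n^d
  into n.\<close>

lemma hs_norm_le_inf_norm:
  assumes "0 < hs_norm n d A" "0 < d"
  shows "hs_norm n d A powr (2 / real d) \<le> real n * inf_norm n d A powr (2 / real d)"
proof -
  let ?M = "inf_norm n d A" and ?H = "hs_norm n d A"
  have fin: "finite (insert 0 ((\<lambda>l. \<bar>A l\<bar>) ` index_tuples n d))" by simp
  have M0: "0 \<le> ?M" unfolding inf_norm_def by (rule Max_ge[OF fin]) simp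
  have M: "\<bar>A l\<bar> \<le> ?M" if "l \<in> index_tuples n d" for l
    unfolding inf_norm_def by (rule Max_ge[OF fin]) (use that in auto)
  have card: "card (index_tuples n d) = n ^ d"
    using card_lists_length_eq[of "{..<n}" d] by (simp add: index_tuples_def conj_commute)
  have "?H\<^sup>2 = (\<Sum>l\<in>index_tuples n d. (A l)\<^sup>2)"
    by (simp add: hs_norm_def sum_nonneg)
  also have "\<dots> \<le> (\<Sum>l\<in>index_tuples n d. ?M\<^sup>2)"
    using M M0 by (intro sum_mono abs_le_square_iff[THEN iffD1]) auto
  also have "\<dots> = real n ^ d * ?M\<^sup>2" by (simp add: card)
  finally have le: "?H\<^sup>2 \<le> real n ^ d * ?M\<^sup>2" .
  moreover have "0 < ?H\<^sup>2" using assms by simp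
  ultimately have prod: "0 < real n ^ d * ?M\<^sup>2" by linarith
  have "n \<noteq> 0"
  proof
    assume "n = 0"
    then show False using prod assms(2) by (simp add: zero_power)
  qed
  moreover have "?M \<noteq> 0" using prod by auto
  ultimately have pos: "0 < real n" "0 < ?M" using M0 by auto
  have "?H powr (2 / real d) = (?H powr 2) powr (1 / real d)" by (simp add: powr_powr)
  also have "\<dots> = (?H\<^sup>2) powr (1 / real d)" using assms by (simp add: powr_numeral)
  also have "\<dots> \<le> (real n ^ d * ?M\<^sup>2) powr (1 / real d)"
    using le by (intro powr_mono2) auto
  also have "\<dots> = (real n powr real d) powr (1 / real d) * (?M powr 2) powr (1 / real d)"
    using pos by (simp add: powr_mult powr_realpow powr_numeral)
  also have "\<dots> = real n * ?M powr (2 / real d)"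
    using assms(2) pos by (simp add: powr_powr del: powr_numeral)
  finally show "?H powr (2 / real d) \<le> real n * ?M powr (2 / real d)" .
qed

lemma inf_norm_eq_0:
  assumes "hs_norm n d A = 0"
  shows "inf_norm n d A = 0"
proof -
  have "\<forall>l\<in>index_tuples n d. A l = 0"
    using assms by (simp add: hs_norm_def sum_nonneg_eq_0_iff)
  then have "insert 0 ((\<lambda>l. \<bar>A l\<bar>) ` index_tuples n d) = {0}" by auto
  then show ?thesis unfolding inf_norm_def by (simp only: Max_singleton)
qed

context ising
begin

text \<open>The factor exp 1 comes from the choice of the moment order, the leading 2 from rounding
  that order down to a power of two.\<close>

definition tail_const :: "nat \<Rightarrow> real" where
  "tail_const d = 2 * exp 1 * (2 * moment_const * (fact d)\<^sup>2)"

lemma tail_const_pos: "0 < tail_const d"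
  using moment_const_pos by (simp add: tail_const_def)

lemma tail_bound:
  assumes d: "d \<in> {1, 2, 3, 4}" and A: "sym_tensor n d A" "vanishing_diag n d A" and t: "0 < t"
  shows "qprob n J h (\<lambda>\<sigma>. \<bar>f d A \<sigma>\<bar> > t)
    \<le> 2 * exp (- (t powr (2 / real d)) / (tail_const d * hs_norm n d A powr (2 / real d)))"
proof (cases "hs_norm n d A = 0")
  case True
  \<comment> \<open>With norm 0 the quotient in the exponent is 0 by the convention for division by
    zero, so the right-hand side is 2.\<close>
  then show ?thesis using qprob_le_1[of n J h "\<lambda>\<sigma>. \<bar>f d A \<sigma>\<bar> > t"] by simp
next
  case False
  let ?H = "hs_norm n d A"
  have H: "0 < ?H" using False hs_norm_nonneg[of n d A] by simp
  have d0: "0 < d" using d by auto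
  define c where "c = 2 * moment_const * (fact d)\<^sup>2"
  define s where "s = (t / ?H) powr (2 / real d)"
  \<comment> \<open>Markov's inequality gives ((c N / s)^d)^N for N = \<open>2 ^ k\<close>. At N = r
    the base c N / s is exp (-1), so r is the order aimed at.\<close>
  define r where "r = s / (exp 1 * c)"
  have c: "0 < c" using moment_const_pos by (simp add: c_def)
  have s: "0 < s" using t H by (simp add: s_def)
  have "s ^ d = s powr real d" using s by (simp add: powr_realpow)
  also have "\<dots> = (t / ?H) powr (2 / real d * real d)" by (simp only: s_def powr_powr)
  also have "\<dots> = (t / ?H)\<^sup>2" using t H d0 by (simp add: powr_numeral)
  finally have s_pow: "s ^ d = (t / ?H)\<^sup>2" .
  have "- (t powr (2 / real d)) / (tail_const d * ?H powr (2 / real d)) = - (r / 2)"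
    using t H by (simp add: r_def s_def tail_const_def c_def powr_divide)
  then have goal: "2 * exp (- (t powr (2 / real d)) / (tail_const d * ?H powr (2 / real d))) = 2 * exp (- (r / 2))"
    by simp
  show ?thesis unfolding goal
  proof (cases "r < 1")
    case True
    \<comment> \<open>For r < 1 no moment is used, since the right-hand side already exceeds
      1.\<close>
    have "1 \<le> 2 * (1 + - (r / 2))" using True by simp
    also have "\<dots> \<le> 2 * exp (- (r / 2))" by (intro mult_left_mono exp_ge_add_one_self) simp
    finally show "qprob n J h (\<lambda>\<sigma>. \<bar>f d A \<sigma>\<bar> > t) \<le> 2 * exp (- (r / 2))"
      using qprob_le_1 by (rule order_trans[rotated])
  next
    case False
    then obtain k :: nat where k: "2 ^ k \<le> r" "r < 2 * 2 ^ k"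
      using dyadic_between[of r] by auto
    let ?N = "(2::nat) ^ k"
    have fact1: "1 \<le> ((fact d)\<^sup>2 :: real)" using fact_ge_1[of d, where 'a = real] by simp
    have "E (\<lambda>y. ((f d A y)\<^sup>2) ^ ?N) \<le> ((2 * moment_const * 2 ^ k) ^ d * (fact d)\<^sup>2 * ?H\<^sup>2) ^ ?N"
      using chaos_moments[OF d, of "{0}" "\<lambda>_. A" k] A by (simp add: hs_norm_def sum_nonneg)
    also have "\<dots> \<le> ((c * 2 ^ k) ^ d * ?H\<^sup>2) ^ ?N"
    proof (intro power_mono mult_right_mono)
      \<comment> \<open>The squared factorial is at least 1 and is enlarged to its d-th power, to
        make the whole prefactor a d-th power.\<close>
      have "(2 * moment_const * 2 ^ k) ^ d * (fact d)\<^sup>2 \<le> (2 * moment_const * 2 ^ k) ^ d * ((fact d)\<^sup>2) ^ d"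
        using fact1 d0 moment_const_pos by (intro mult_left_mono self_le_power) auto
      then show "(2 * moment_const * 2 ^ k) ^ d * (fact d)\<^sup>2 \<le> (c * 2 ^ k) ^ d"
        by (simp add: c_def power_mult_distrib mult_ac)
    qed (use moment_const_pos in auto)
    finally have "E (\<lambda>y. ((f d A y)\<^sup>2) ^ ?N) / (t\<^sup>2) ^ ?N \<le> ((c * 2 ^ k) ^ d * ?H\<^sup>2) ^ ?N / (t\<^sup>2) ^ ?N"
      by (intro divide_right_mono) auto
    also have "\<dots> = ((c * 2 ^ k / s) ^ d) ^ ?N"
      using t H by (simp add: power_divide s_pow)
    also have "\<dots> \<le> ((exp (- 1)) ^ d) ^ ?N"
    proof (intro power_mono)
      have "c * 2 ^ k \<le> c * r" using k c by (intro mult_left_mono) auto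
      also have "\<dots> = s * exp (- 1)" using c by (simp add: r_def exp_minus field_simps)
      finally show "c * 2 ^ k / s \<le> exp (- 1)" using s by (simp add: pos_divide_le_eq mult.commute)
    qed (use c s in auto)
    also have "\<dots> = exp (- (real d * 2 ^ k))"
      by (simp add: exp_of_nat_mult[symmetric] power_mult[symmetric])
    also have "\<dots> \<le> exp (- (r / 2))"
    proof -
      have "1 * 2 ^ k \<le> real d * 2 ^ k" using d0 by (intro mult_right_mono) auto
      then have "r / 2 \<le> real d * 2 ^ k" using k by linarith
      then show ?thesis by simp
    qed
    also have "\<dots> \<le> 2 * exp (- (r / 2))" by simp
    finally show "qprob n J h (\<lambda>\<sigma>. \<bar>f d A \<sigma>\<bar> > t) \<le> 2 * exp (- (r / 2))"
      using qprob_markov[OF t] by (rule order_trans[rotated])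
  qed
qed

end

theorem theorem1p4:
  fixes \<alpha> \<alpha>' :: real and d :: nat
  assumes "0 < \<alpha>" and "\<alpha> \<le> 1" and "0 \<le> \<alpha>'" and "d \<in> {1, 2, 3, 4}"
  shows "\<exists>C>0. \<forall>(n::nat) (J::nat \<Rightarrow> nat \<Rightarrow> real) (h::nat \<Rightarrow> real) (A::nat list \<Rightarrow> real).
    (\<forall>i<n. \<forall>j<n. J i j = J j i) \<and> (\<forall>i<n. J i i = 0) \<and>
    (\<forall>i<n. (\<Sum>j<n. \<bar>J i j\<bar>) \<le> 1 - \<alpha>) \<and>
    (\<forall>i<n. \<bar>h i\<bar> \<le> \<alpha>') \<and>
    sym_tensor n d A \<and> vanishing_diag n d A \<longrightarrow>
    (\<forall>t>0.
      qprob n J h (\<lambda>\<sigma>. \<bar>fdA n J h d A \<sigma> - qE n J h (fdA n J h d A)\<bar> > t)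
        \<le> 2 * exp (- (t powr (2 / real d)) / (C * hs_norm n d A powr (2 / real d)))
      \<and> 2 * exp (- (t powr (2 / real d)) / (C * hs_norm n d A powr (2 / real d)))
        \<le> 2 * exp (- (t powr (2 / real d)) / (C * real n * inf_norm n d A powr (2 / real d))))"
proof (intro exI[of _ "ising.tail_const \<alpha> \<alpha>' d"] conjI allI impI)
  \<comment> \<open>The constant depends only on \<alpha>, \<alpha>' and d. The system without spins
    makes its positivity available before n, J and h are fixed.\<close>
  interpret empty: ising 0 "\<lambda>_ _. 0" "\<lambda>_. 0" \<alpha> \<alpha>'
    using assms by unfold_locales auto
  show C: "0 < ising.tail_const \<alpha> \<alpha>' d" by (rule empty.tail_const_pos)
  fix n J h A and t :: real
  assume *: "(\<forall>i<n. \<forall>j<n. J i j = J j i) \<and> (\<forall>i<n. J i i = 0) \<and>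
    (\<forall>i<n. (\<Sum>j<n. \<bar>J i j\<bar>) \<le> 1 - \<alpha>) \<and> (\<forall>i<n. \<bar>h i\<bar> \<le> \<alpha>') \<and>
    sym_tensor n d A \<and> vanishing_diag n d A" and t: "0 < t"
  interpret ising n J h \<alpha> \<alpha>'
    using assms * by unfold_locales auto
  show "qprob n J h (\<lambda>\<sigma>. \<bar>fdA n J h d A \<sigma> - qE n J h (fdA n J h d A)\<bar> > t)
      \<le> 2 * exp (- (t powr (2 / real d)) / (ising.tail_const \<alpha> \<alpha>' d * hs_norm n d A powr (2 / real d)))"
    using tail_bound[OF assms(4), of A t] * t by (simp add: E_fdA[OF assms(4)])
  let ?C = "ising.tail_const \<alpha> \<alpha>' d"
  show "2 * exp (- (t powr (2 / real d)) / (?C * hs_norm n d A powr (2 / real d)))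
      \<le> 2 * exp (- (t powr (2 / real d)) / (?C * real n * inf_norm n d A powr (2 / real d)))"
  proof (cases "hs_norm n d A = 0")
    case True
    \<comment> \<open>Both norms vanish, both quotients are 0 by convention, and both sides equal
      2.\<close>
    then show ?thesis by (simp add: inf_norm_eq_0)
  next
    case False
    then have H: "0 < hs_norm n d A" using hs_norm_nonneg[of n d A] by simp
    have d: "0 < d" using assms(4) by auto
    have "t powr (2 / real d) / (?C * (real n * inf_norm n d A powr (2 / real d)))
        \<le> t powr (2 / real d) / (?C * hs_norm n d A powr (2 / real d))"
      using hs_norm_le_inf_norm[OF H d] C H by (intro frac_le mult_left_mono mult_pos_pos) auto
    then show ?thesis by (simp add: mult.assoc)
  qed
qed

end
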